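(* Let $A$ be a finite alphabet and let $S\subset A^*$ be a uniformly recurrent tree set. Then every basis $X$ of the free group on $A$ such that $X\subset S$ is tame.
   Context: Words and sets. $A$ is a finite nonempty alphabet, $A^*$ the free monoid of finite words over $A$, $A^+$ the set of nonempty words. A set $S$ of words is factorial if it contains all factors of its elements. A factorial set $S$ is right-extendable if for every $w\in S$ there is a letter $a$ with $wa\in S$, and biextendable if for every $w\in S$ there are letters $a,b$ with $awb\in S$. A set $S$ is uniformly recurrent if it is (nonempty) factorial and right-extendable and for every $u\in S$ there is $n\ge 1$ such that $u$ is a factor of every word of $S$ of length $n$. Tree sets. For a factorial set $S$ and $w\in S$, let $L(w)=\{a\in A\mid aw\in S\}$, $R(w)=\{a\in A\mid wa\in S\}$, $E(w)=\{(a,b)\in A\times A\mid awb\in S\}$. The extension graph $G(w)$ is the undirected graph whose vertex set is the disjoint union of $L(w)$ and $R(w)$ and whose edges are the pairs $(a,b)\in E(w)$ (joining $a\in L(w)$ to $b\in R(w)$). $S$ is a tree set if it is factorial, biextendable, and for every $w\in S$ (including the empty word) the graph $G(w)$ is a tree, i.e. connected and acyclic. Tame bases. $A^*$ is viewed inside the free group on $A$. An automorphism $\alpha$ of the free group on $A$ is positive if $\alpha(a)\in A^+$ for every $a\in A$. For $a,b\in A$ with $a\neq b$, let $\alpha_{a,b}$ be the automorphism with $a\mapsto ab$ and $c\mapsto c$ for every letter $c\ne a$, and let $\tilde\alpha_{a,b}$ be the automorphism with $a\mapsto ba$ and $c\mapsto c$ for every letter $c\neq a$. A positive automorphism is tame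 if it belongs to the submonoid (under composition) generated by the permutations of $A$ and all the $\alpha_{a,b}$, $\tilde\alpha_{a,b}$ ($a\ne b$). A basis $X\subset A^+$ of the free group on $A$ is tame if $X=\alpha(A)$ for some tame automorphism $\alpha$. *)

theory Defs
  imports "HOL-Algebra.Bij" "HOL-Library.Sublist"
begin

section \<open>Sets of words\<close>

text \<open>
  The alphabet is the type \<open>'a :: finite\<close>; words are lists and \<^const>\<open>sublist\<close> is the
  (contiguous) factor relation.
\<close>

definition factorial_set :: "'a list set \<Rightarrow> bool" where
  "factorial_set S \<longleftrightarrow> (\<forall>w\<in>S. \<forall>u. sublist u w \<longrightarrow> u \<in> S)"

definition right_extendable :: "'a list set \<Rightarrow> bool" where
  "right_extendable S \<longleftrightarrow> (\<forall>w\<in>S. \<exists>a. w @ [a] \<in> S)"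

definition biextendable :: "'a list set \<Rightarrow> bool" where
  "biextendable S \<longleftrightarrow> (\<forall>w\<in>S. \<exists>a b. a # w @ [b] \<in> S)"

definition uniformly_recurrent :: "'a list set \<Rightarrow> bool" where
  "uniformly_recurrent S \<longleftrightarrow>
     S \<noteq> {} \<and> factorial_set S \<and> right_extendable S \<and>
     (\<forall>u\<in>S. \<exists>n\<ge>1. \<forall>w\<in>S. length w = n \<longrightarrow> sublist u w)"


section \<open>Trees and tree sets\<close>

text \<open>
  Simple undirected graphs, given by a vertex set \<open>V\<close> and a set \<open>E\<close> of two-element edges.
\<close>

definition graph_connected :: "'v set \<Rightarrow> 'v set set \<Rightarrow> bool" where
  "graph_connected V E \<longleftrightarrow>
     V \<noteq> {} \<and> (\<forall>u\<in>V. \<forall>v\<in>V. (u, v) \<in> {(x, y). {x, y} \<in> E}\<^sup>*)"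

definition graph_cycle :: "'v set set \<Rightarrow> 'v list \<Rightarrow> bool" where
  "graph_cycle E p \<longleftrightarrow>
     length p \<ge> 3 \<and> distinct p \<and> successively (\<lambda>x y. {x, y} \<in> E) p \<and> {last p, hd p} \<in> E"

definition graph_tree :: "'v set \<Rightarrow> 'v set set \<Rightarrow> bool" where
  "graph_tree V E \<longleftrightarrow> graph_connected V E \<and> (\<nexists>p. graph_cycle E p)"

definition left_ext :: "'a list set \<Rightarrow> 'a list \<Rightarrow> 'a set" where
  "left_ext S w = {a. a # w \<in> S}"

definition right_ext :: "'a list set \<Rightarrow> 'a list \<Rightarrow> 'a set" where
  "right_ext S w = {a. w @ [a] \<in> S}"

definition bi_ext :: "'a list set \<Rightarrow> 'a list \<Rightarrow> ('a \<times> 'a) set" where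
  "bi_ext S w = {(a, b). a # w @ [b] \<in> S}"

definition ext_graph_verts :: "'a list set \<Rightarrow> 'a list \<Rightarrow> ('a + 'a) set" where
  "ext_graph_verts S w = left_ext S w <+> right_ext S w"

definition ext_graph_edges :: "'a list set \<Rightarrow> 'a list \<Rightarrow> ('a + 'a) set set" where
  "ext_graph_edges S w = {{Inl a, Inr b} | a b. (a, b) \<in> bi_ext S w}"

definition tree_set :: "'a list set \<Rightarrow> bool" where
  "tree_set S \<longleftrightarrow> factorial_set S \<and> biextendable S \<and>
     (\<forall>w\<in>S. graph_tree (ext_graph_verts S w) (ext_graph_edges S w))"


section \<open>Free groups\<close>

text \<open>
  The free group on a set \<open>X\<close>, realised on the reduced words over \<open>X\<close> and its formal inverses:
  \<open>(x, True)\<close> stands for the generator \<open>x\<close> and \<open>(x, False)\<close> for its inverse.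
\<close>

definition inv_letter :: "'x \<times> bool \<Rightarrow> 'x \<times> bool" where
  "inv_letter l = (fst l, \<not> snd l)"

definition reduced :: "('x \<times> bool) list \<Rightarrow> bool" where
  "reduced w \<longleftrightarrow> successively (\<lambda>k l. l \<noteq> inv_letter k) w"

fun cons_red :: "'x \<times> bool \<Rightarrow> ('x \<times> bool) list \<Rightarrow> ('x \<times> bool) list" where
  "cons_red l [] = [l]"
| "cons_red l (k # w) = (if k = inv_letter l then w else l # k # w)"

definition free_group :: "'x set \<Rightarrow> ('x \<times> bool) list monoid" where
  "free_group X =
     \<lparr>carrier = {w. reduced w \<and> fst ` set w \<subseteq> X},
      mult = \<lambda>u v. foldr cons_red u v,
      one = []\<rparr>"

lemma inv_letter_inv_letter [simp]: "inv_letter (inv_letter l) = l"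
  by (simp add: inv_letter_def)

lemma inv_letter_neq [simp]: "inv_letter l \<noteq> l" "l \<noteq> inv_letter l"
  by (cases l, simp add: inv_letter_def)+

lemma fst_inv_letter [simp]: "fst (inv_letter l) = fst l"
  by (simp add: inv_letter_def)

lemma reduced_Nil [simp]: "reduced []"
  by (simp add: reduced_def)

lemma reduced_single [simp]: "reduced [l]"
  by (simp add: reduced_def)

lemma reduced_Cons_Cons [simp]:
  "reduced (k # l # w) \<longleftrightarrow> l \<noteq> inv_letter k \<and> reduced (l # w)"
  by (simp add: reduced_def)

lemma reduced_ConsD: "reduced (l # w) \<Longrightarrow> reduced w"
  by (cases w) auto

lemma reduced_cons_red: "reduced w \<Longrightarrow> reduced (cons_red l w)"
  by (cases w) (auto dest: reduced_ConsD)

lemma cons_red_eq_Cons: "reduced (l # w) \<Longrightarrow> cons_red l w = l # w"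
  by (cases w) auto

lemma cons_red_inv: "reduced w \<Longrightarrow> cons_red l (cons_red (inv_letter l) w) = w"
  by (cases w) (auto simp: cons_red_eq_Cons)

lemma set_cons_red: "set (cons_red l w) \<subseteq> insert l (set w)"
  by (cases w) auto

lemma reduced_foldr_cons_red: "reduced v \<Longrightarrow> reduced (foldr cons_red u v)"
  by (induction u) (auto intro: reduced_cons_red)

lemma set_foldr_cons_red: "set (foldr cons_red u v) \<subseteq> set u \<union> set v"
  by (induction u) (use set_cons_red in fastforce)+

lemma foldr_cons_red_cons_red:
  assumes "reduced w"
  shows "foldr cons_red (cons_red l v) w = cons_red l (foldr cons_red v w)"
proof (cases v)
  case (Cons k v')
  show ?thesis
    using cons_red_inv[OF reduced_foldr_cons_red[OF assms], of l v'] Cons by auto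
qed simp

lemma foldr_cons_red_assoc:
  assumes "reduced w"
  shows "foldr cons_red (foldr cons_red u v) w = foldr cons_red u (foldr cons_red v w)"
  using assms by (induction u) (auto simp: foldr_cons_red_cons_red)

lemma foldr_cons_red_Nil: "reduced u \<Longrightarrow> foldr cons_red u [] = u"
proof (induction u)
  case (Cons l u)
  then have "foldr cons_red u [] = u" by (blast dest: reduced_ConsD)
  with Cons.prems show ?case by (simp add: cons_red_eq_Cons)
qed simp

lemma foldr_cons_red_inverse:
  assumes "reduced w"
  shows "foldr cons_red (rev (map inv_letter u)) (foldr cons_red u w) = w"
  using assms
proof (induction u arbitrary: w)
  case (Cons l u)
  have "cons_red (inv_letter l) (cons_red l (foldr cons_red u w)) = foldr cons_red u w"
    using cons_red_inv[OF reduced_foldr_cons_red[OF Cons.prems], of "inv_letter l" u] by simp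
  then show ?case using Cons by simp
qed simp

lemma group_free_group: "group (free_group X)"
proof (rule groupI)
  fix u v assume "u \<in> carrier (free_group X)" "v \<in> carrier (free_group X)"
  then show "u \<otimes>\<^bsub>free_group X\<^esub> v \<in> carrier (free_group X)"
    using set_foldr_cons_red[of u v]
    by (fastforce simp: free_group_def reduced_foldr_cons_red)
next
  fix u assume u: "u \<in> carrier (free_group X)"
  define v where "v = foldr cons_red (rev (map inv_letter u)) []"
  have "v \<in> carrier (free_group X)"
    using u set_foldr_cons_red[of "rev (map inv_letter u)" "[]"]
    by (fastforce simp: free_group_def v_def reduced_foldr_cons_red)
  moreover have "v \<otimes>\<^bsub>free_group X\<^esub> u = \<one>\<^bsub>free_group X\<^esub>"
    using u foldr_cons_red_inverse[of "[]" u]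
    by (simp add: free_group_def v_def foldr_cons_red_assoc foldr_cons_red_Nil)
  ultimately show "\<exists>v\<in>carrier (free_group X). v \<otimes>\<^bsub>free_group X\<^esub> u = \<one>\<^bsub>free_group X\<^esub>" by blast
qed (auto simp: free_group_def foldr_cons_red_assoc)

text \<open>
  The value in \<open>G\<close> of a word over elements of \<open>G\<close> and their formal inverses. A set \<open>X\<close> is a basis
  of \<open>G\<close> if this is an isomorphism from the free group on \<open>X\<close> onto \<open>G\<close>.
\<close>

definition eval_word :: "('g, 'm) monoid_scheme \<Rightarrow> ('g \<times> bool) list \<Rightarrow> 'g" where
  "eval_word G w =
     foldr (\<lambda>(x, s) y. (if s then x else inv\<^bsub>G\<^esub> x) \<otimes>\<^bsub>G\<^esub> y) w \<one>\<^bsub>G\<^esub>"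

definition free_basis :: "('g, 'm) monoid_scheme \<Rightarrow> 'g set \<Rightarrow> bool" where
  "free_basis G X \<longleftrightarrow> X \<subseteq> carrier G \<and> eval_word G \<in> iso (free_group X) G"

abbreviation FG :: "('a \<times> bool) list monoid" where
  "FG \<equiv> free_group UNIV"

text \<open>The embedding of the free monoid into the free group.\<close>

definition of_word :: "'a list \<Rightarrow> ('a \<times> bool) list" where
  "of_word w = map (\<lambda>a. (a, True)) w"

abbreviation gen :: "'a \<Rightarrow> ('a \<times> bool) list" where
  "gen a \<equiv> of_word [a]"

lemma inj_of_word: "inj of_word"
  by (auto simp: of_word_def intro!: injI inj_onI elim: map_injective)

lemma of_word_in_FG: "of_word w \<in> carrier FG"
proof -
  have "reduced (of_word w)"
  proof (induction w)
    case (Cons a w)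
    then show ?case
      by (cases w) (auto simp: of_word_def inv_letter_def reduced_def)
  qed (simp add: of_word_def)
  then show ?thesis by (simp add: free_group_def)
qed

lemma of_word_append: "of_word (u @ v) = of_word u \<otimes>\<^bsub>FG\<^esub> of_word v"
proof (induction u)
  case (Cons a u)
  have "cons_red (a, True) (of_word w) = of_word (a # w)" for w
    by (cases w) (auto simp: of_word_def inv_letter_def)
  from this[of "u @ v"] Cons show ?case by (simp add: free_group_def of_word_def)
qed (simp add: free_group_def of_word_def)


section \<open>Tame automorphisms and tame bases\<close>

definition positive_words :: "('a \<times> bool) list set" where
  "positive_words = of_word ` {w. w \<noteq> []}"

definition positive_auto :: "(('a \<times> bool) list \<Rightarrow> ('a \<times> bool) list) \<Rightarrow> bool" where
  "positive_auto \<alpha> \<longleftrightarrow> \<alpha> \<in> auto FG \<and> (\<forall>a. \<alpha> (gen a) \<in> positive_words)"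

text \<open>
  An automorphism is determined by its values on the letters (elements of \<^term>\<open>auto FG\<close>
  are moreover extensional), so each set below consists of the named automorphisms only.
\<close>

definition perm_autos :: "(('a \<times> bool) list \<Rightarrow> ('a \<times> bool) list) set" where
  "perm_autos = {\<alpha> \<in> auto FG. \<exists>\<pi>. bij \<pi> \<and> (\<forall>c. \<alpha> (gen c) = gen (\<pi> c))}"

definition right_mult_autos :: "(('a \<times> bool) list \<Rightarrow> ('a \<times> bool) list) set" where
  "right_mult_autos = {\<alpha> \<in> auto FG. \<exists>a b. a \<noteq> b \<and>
     \<alpha> (gen a) = of_word [a, b] \<and> (\<forall>c. c \<noteq> a \<longrightarrow> \<alpha> (gen c) = gen c)}"

definition left_mult_autos :: "(('a \<times> bool) list \<Rightarrow> ('a \<times> bool) list) set" where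
  "left_mult_autos = {\<alpha> \<in> auto FG. \<exists>a b. a \<noteq> b \<and>
     \<alpha> (gen a) = of_word [b, a] \<and> (\<forall>c. c \<noteq> a \<longrightarrow> \<alpha> (gen c) = gen c)}"

inductive_set submonoid_generated :: "('g, 'm) monoid_scheme \<Rightarrow> 'g set \<Rightarrow> 'g set"
  for G and H where
  one: "\<one>\<^bsub>G\<^esub> \<in> submonoid_generated G H"
| incl: "h \<in> H \<Longrightarrow> h \<in> submonoid_generated G H"
| mult: "g \<in> submonoid_generated G H \<Longrightarrow> h \<in> submonoid_generated G H
    \<Longrightarrow> g \<otimes>\<^bsub>G\<^esub> h \<in> submonoid_generated G H"

text \<open>Multiplication in \<^term>\<open>AutoGroup FG\<close> is composition of maps.\<close>

definition tame_auto :: "(('a \<times> bool) list \<Rightarrow> ('a \<times> bool) list) \<Rightarrow> bool" where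
  "tame_auto \<alpha> \<longleftrightarrow> positive_auto \<alpha> \<and>
     \<alpha> \<in> submonoid_generated (AutoGroup FG)
           (perm_autos \<union> right_mult_autos \<union> left_mult_autos)"

definition tame_basis :: "('a \<times> bool) list set \<Rightarrow> bool" where
  "tame_basis X \<longleftrightarrow> free_basis FG X \<and> X \<subseteq> positive_words \<and>
     (\<exists>\<alpha>. tame_auto \<alpha> \<and> X = \<alpha> ` range gen)"

end

(*
  Write X = of_word ` Y with Y a set of words of S. If Y is not bifix, some y in Y factors as
  u v or v u with u in Y, u \<noteq> y. Replacing y by v keeps a generating set of the free group inside S
  and shortens it, while the inverse operation is an elementary positive automorphism; since Y has
  at most as many elements as there are letters, it does not collapse. So, by induction on the total
  length, it remains to see that a bifix code Y in S generating the free group is the alphabet.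

  For this, call two proper nonempty prefixes p, p' of Y adjacent if p q and p' q both lie in Y for
  some q, and take the classes of connected prefixes as the states of an automaton reading letters,
  the words of Y and the empty word forming one more state. Acyclicity of the extension graphs makes
  the bipartite graph of factorisations p q in Y a forest in which every connected component has a
  suffix code on the left and a prefix code on the right, and this shows that the automaton is
  deterministic and codeterministic (it is the Stallings automaton of the subgroup generated by Y).
  Hence every element of that subgroup labels a loop at the state of the empty word. If a letter
  labels such a loop, it belongs to Y.
*)
theory Submission
  imports Defs "HOL-Algebra.Generated_Groups"
begin

section \<open>Forests of bipartite edges\<close>

text \<open>The first vertex of a longest path has a neighbour other than the second vertex. By
  maximality it lies on the path, and so it closes a cycle.\<close>

lemma graph_cycle_if_no_leaf:
  assumes "finite V" and V: "\<And>x y. {x, y} \<in> E \<Longrightarrow> x \<in> V" and irr: "\<And>x. {x} \<notin> E"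
    and branch: "\<And>x y. {x, y} \<in> E \<Longrightarrow> \<exists>z. z \<noteq> y \<and> {x, z} \<in> E"
    and edge: "{x0, y0} \<in> E"
  shows "\<exists>p. graph_cycle E p"
proof -
  define path where "path p \<longleftrightarrow> length p \<ge> 2 \<and> distinct p \<and> successively (\<lambda>x y. {x, y} \<in> E) p" for p
  have sub: "set p \<subseteq> V" if "path p" for p
  proof
    fix x assume "x \<in> set p"
    then obtain i where i: "i < length p" "x = p ! i" by (auto simp: in_set_conv_nth)
    show "x \<in> V"
    proof (cases "Suc i < length p")
      case True
      then have "{p ! i, p ! Suc i} \<in> E"
        using that by (simp add: path_def successively_conv_nth)
      then show ?thesis using V i by auto
    next
      case False
      with i that have "Suc (i - 1) = i" by (auto simp: path_def)
      then have "{p ! (i - 1), p ! i} \<in> E"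
        using that i by (metis path_def successively_conv_nth)
      then show ?thesis using V i by (metis insert_commute)
    qed
  qed
  have len: "length p \<le> card V" if "path p" for p
    using sub[OF that] that \<open>finite V\<close> by (metis card_mono distinct_card path_def)
  have "x0 \<noteq> y0" using edge irr by auto
  then have "path [x0, y0]" using edge by (simp add: path_def)
  then obtain p where p: "path p" and max: "\<And>q. path q \<Longrightarrow> length q \<le> length p"
    using len ex_has_greatest_nat[of path "[x0, y0]" length "Suc (card V)"] by (auto simp: less_Suc_eq_le)
  then obtain x y r where xyr: "p = x # y # r"
    by (cases p; cases "tl p") (auto simp: path_def)
  with p have "{x, y} \<in> E" by (auto simp: path_def)
  with branch obtain z where z: "z \<noteq> y" "{x, z} \<in> E" by blast
  then have "z \<noteq> x" using irr by auto
  have "\<not> path (z # p)" using max by fastforce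
  then have "z \<in> set p" using p z xyr by (auto simp: path_def insert_commute)
  with z \<open>z \<noteq> x\<close> xyr have "z \<in> set r" by auto
  then obtain r1 r2 where "r = r1 @ z # r2" by (meson split_list)
  with xyr have split: "p = (x # y # r1 @ [z]) @ r2" by simp
  have "distinct (x # y # r1 @ [z])" "successively (\<lambda>x y. {x, y} \<in> E) (x # y # r1 @ [z])"
    using p unfolding path_def split successively_append_iff distinct_append by blast+
  then have "graph_cycle E (x # y # r1 @ [z])"
    using z by (simp add: graph_cycle_def insert_commute)
  then show ?thesis by blast
qed

text \<open>Acyclicity of a bipartite graph as an edge count: a finite nonempty set of edges has
  fewer edges than endpoints. In this form bounds for several graphs can be added up.\<close>

definition forest :: "('u \<times> 'v) set \<Rightarrow> bool" where
  "forest E \<longleftrightarrow> (\<forall>F\<subseteq>E. finite F \<longrightarrow> F \<noteq> {} \<longrightarrow> card F < card (fst ` F) + card (snd ` F))"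

text \<open>A violating edge set of least size has no leaf, since a leaf could be removed together
  with its edge; a finite graph without leaves contains a cycle.\<close>

lemma forest_if_acyclic:
  assumes acyc: "\<nexists>p. graph_cycle {{Inl a, Inr b} | a b. (a, b) \<in> E} p"
  shows "forest E"
proof (rule ccontr)
  define bad where
    "bad F \<longleftrightarrow> F \<subseteq> E \<and> finite F \<and> F \<noteq> {} \<and> card (fst ` F) + card (snd ` F) \<le> card F" for F
  assume "\<not> forest E"
  then obtain F0 where "bad F0"
    by (auto simp: forest_def not_less bad_def)
  then obtain F where "bad F" and min: "\<And>G. bad G \<Longrightarrow> card F \<le> card G"
    using ex_has_least_nat[of bad F0 card] by blast
  then have F: "F \<subseteq> E" "finite F" "F \<noteq> {}" "card (fst ` F) + card (snd ` F) \<le> card F"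
    by (simp_all add: bad_def)
  have drop: "fst ` (F - {e}) = fst ` F \<and> snd ` (F - {e}) = snd ` F" if e: "e \<in> F" for e
  proof (rule ccontr)
    assume *: "\<not> ?thesis"
    have "card (fst ` (F - {e})) \<le> card (fst ` F)" "card (snd ` (F - {e})) \<le> card (snd ` F)"
      using F by (auto intro!: card_mono)
    moreover have "card (fst ` (F - {e})) < card (fst ` F) \<or> card (snd ` (F - {e})) < card (snd ` F)"
      using F * by (meson Diff_subset finite_imageI image_mono psubsetI psubset_card_mono)
    moreover have "card (F - {e}) = card F - 1" "card F > 0"
      using F e by (auto simp: card_gt_0_iff)
    ultimately have "card (fst ` (F - {e})) + card (snd ` (F - {e})) \<le> card (F - {e})"
      using F by linarith
    \<comment> \<open>A single edge has two endpoints, so a one-edge set satisfies the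
      bound.\<close>
    moreover have "F - {e} \<noteq> {}"
    proof
      assume "F - {e} = {}"
      with e have "F = {e}" by blast
      with F show False by simp
    qed
    ultimately have "card F \<le> card (F - {e})" using min[of "F - {e}"] F by (auto simp: bad_def)
    then show False using \<open>card (F - {e}) = card F - 1\<close> \<open>card F > 0\<close> by linarith
  qed
  define E' where "E' = {{Inl a, Inr b} | a b. (a, b) \<in> F}"
  have E'I: "{Inl a, Inr b} \<in> E'" "{Inr b, Inl a} \<in> E'" if "(a, b) \<in> F" for a b
  proof -
    show "{Inl a, Inr b} \<in> E'" unfolding E'_def using that by auto
    then show "{Inr b, Inl a} \<in> E'" by (simp only: insert_commute)
  qed
  have E'D: "\<exists>a b. (a, b) \<in> F \<and> (x = Inl a \<and> y = Inr b \<or> x = Inr b \<and> y = Inl a)"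
    if "{x, y} \<in> E'" for x y
    using that by (auto simp: E'_def doubleton_eq_iff)
  have branch: "\<exists>z. z \<noteq> y \<and> {x, z} \<in> E'" if xy: "{x, y} \<in> E'" for x y
  proof -
    from E'D[OF xy] obtain a b where ab: "(a, b) \<in> F" "x = Inl a \<and> y = Inr b \<or> x = Inr b \<and> y = Inl a"
      by blast
    have "a \<in> fst ` F" "b \<in> snd ` F" using ab(1) by (force simp: image_iff)+
    then have "a \<in> fst ` (F - {(a, b)})" "b \<in> snd ` (F - {(a, b)})"
      using drop[OF ab(1)] by blast+
    then obtain e1 e2 where "e1 \<in> F - {(a, b)}" "fst e1 = a" "e2 \<in> F - {(a, b)}" "snd e2 = b"
      by blast
    then obtain a' b' where "(a, b') \<in> F" "b' \<noteq> b" "(a', b) \<in> F" "a' \<noteq> a"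
      by (cases e1; cases e2) auto
    then have "{Inl a, Inr b'} \<in> E'" "{Inr b, Inl a'} \<in> E'" by (simp_all only: E'I)
    then show ?thesis using ab(2) \<open>a' \<noteq> a\<close> \<open>b' \<noteq> b\<close> by (metis sum.inject)
  qed
  obtain a b where "(a, b) \<in> F" using F by auto
  then have edge: "{Inl a, Inr b} \<in> E'" by (rule E'I)
  have verts: "x \<in> Inl ` fst ` F \<union> Inr ` snd ` F" if "{x, y} \<in> E'" for x y
    using E'D[OF that] by (auto intro: rev_image_eqI)
  have irr: "{x} \<notin> E'" for x
    using E'D[of x x] by auto
  have fin: "finite (Inl ` fst ` F \<union> Inr ` snd ` F)" using F(2) by simp
  from graph_cycle_if_no_leaf[of _ E', OF fin] obtain p where p: "graph_cycle E' p"
    using verts irr branch edge by metis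
  have sub: "E' \<subseteq> {{Inl a, Inr b} | a b. (a, b) \<in> E}" using F(1) by (auto simp: E'_def)
  have "graph_cycle {{Inl a, Inr b} | a b. (a, b) \<in> E} p"
    using p successively_mono[of "\<lambda>x y. {x, y} \<in> E'" p "\<lambda>x y. {x, y} \<in> {{Inl a, Inr b} | a b. (a, b) \<in> E}"] subsetD[OF sub]
    unfolding graph_cycle_def by blast
  with acyc show False by blast
qed

section \<open>Edge counts of stars and contractions\<close>

lemma card_lt_if_singleton_side:
  assumes "finite F" "F \<noteq> {}" and "card (fst ` F) = 1 \<or> card (snd ` F) = 1"
  shows "card F < card (fst ` F) + card (snd ` F)"
proof -
  have "F \<subseteq> fst ` F \<times> snd ` F" by force
  then have "card F \<le> card (fst ` F) * card (snd ` F)"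
    using assms(1) by (metis card_cartesian_product card_mono finite_SigmaI finite_imageI)
  then show ?thesis using assms(3) by auto
qed

text \<open>Only edges of \<open>FK\<close> can be identified: their image is the star joining
  \<open>c\<close> to the right ends of \<open>FK\<close>, and the condition on \<open>c\<close>
  keeps this star disjoint from the remaining edges.\<close>

lemma card_contract:
  fixes F :: "('u \<times> 'v) set" and K :: "'u set" and c :: 'u
  defines "FK \<equiv> {e \<in> F. fst e \<in> K}"
    and "F' \<equiv> (\<lambda>(u, v). (if u \<in> K then c else u, v)) ` F"
  assumes "finite F" "FK \<noteq> {}" "c \<notin> fst ` F - K"
  shows "card F' + card FK = card F + card (snd ` FK)"
    and "card (fst ` F') + card (fst ` FK) = card (fst ` F) + 1"
    and "snd ` F' = snd ` F"
proof -
  define m where "m = (\<lambda>(u, v). (if u \<in> K then c else u, v :: 'v))"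
  have "F = (F - FK) \<union> FK" by (auto simp: FK_def)
  then have "F' = m ` (F - FK) \<union> m ` FK" unfolding F'_def m_def by (metis image_Un)
  moreover have "m e = e" if "e \<in> F - FK" for e using that by (cases e) (auto simp: m_def FK_def)
  then have "m ` (F - FK) = F - FK" by force
  moreover have "m ` FK = {c} \<times> snd ` FK" by (force simp: m_def FK_def image_iff)
  ultimately have F': "F' = (F - FK) \<union> {c} \<times> snd ` FK" by simp
  have fin: "finite FK" using assms(3) by (simp add: FK_def)
  have "(F - FK) \<inter> {c} \<times> snd ` FK = {}" using assms(5) by (force simp: FK_def)
  then have "card F' = card (F - FK) + card (snd ` FK)"
    using assms(3) fin by (simp add: F' card_Un_disjoint card_cartesian_product)
  moreover have "card F = card (F - FK) + card FK"
    using assms(3) fin by (simp add: FK_def card_Diff_subset card_mono)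
  ultimately show "card F' + card FK = card F + card (snd ` FK)" by simp
  have "fst ` F' = insert c (fst ` F - K)"
    using assms(4) by (auto simp: F' FK_def image_Un image_iff)
  moreover have "fst ` FK = fst ` F \<inter> K" by (auto simp: FK_def)
  moreover have "card (fst ` F) = card (fst ` F - K) + card (fst ` F \<inter> K)"
    using assms(3) card_Diff_subset_Int[of "fst ` F" K] card_mono[of "fst ` F" "fst ` F \<inter> K"] by simp
  ultimately show "card (fst ` F') + card (fst ` FK) = card (fst ` F) + 1"
    using assms(3,5) by simp
  show "snd ` F' = snd ` F" by (simp add: F'_def image_image case_prod_unfold)
qed

text \<open>Connectedness as growth edge by edge keeps the edge set finite and makes the number of
  endpoints easy to follow.\<close>

inductive conn :: "('u \<times> 'v) set \<Rightarrow> bool" where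
  single: "conn {e}"
| grow: "conn F \<Longrightarrow> fst e \<in> fst ` F \<or> snd e \<in> snd ` F \<Longrightarrow> conn (insert e F)"

lemma conn_finite: "conn F \<Longrightarrow> finite F \<and> F \<noteq> {}"
  by (induction rule: conn.induct) auto

text \<open>Each added edge shares an endpoint with the earlier ones and so brings at most one new
  vertex.\<close>

lemma conn_card: "conn F \<Longrightarrow> card (fst ` F) + card (snd ` F) \<le> card F + 1"
proof (induction rule: conn.induct)
  case (grow F e)
  then have "finite F" using conn_finite by blast
  show ?case
  proof (cases "e \<in> F")
    case True
    then show ?thesis using grow by (simp add: insert_absorb)
  next
    case False
    then show ?thesis using grow \<open>finite F\<close> by (auto simp: card_insert_if split: if_splits)
  qed
qed simp

lemma conn_map_prod: "conn F \<Longrightarrow> conn (map_prod f g ` F)"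
proof (induction rule: conn.induct)
  case (grow F e)
  have "fst ` map_prod f g ` F = f ` fst ` F" "snd ` map_prod f g ` F = g ` snd ` F"
    by (simp_all add: image_image)
  then have "fst (map_prod f g e) \<in> fst ` map_prod f g ` F \<or> snd (map_prod f g e) \<in> snd ` map_prod f g ` F"
    using grow.hyps(2) by auto
  then show ?case using conn.grow[OF grow.IH] by simp
qed (simp add: conn.single)

text \<open>This reverses \<open>conn_card\<close> for forests. If a largest connected part left
  edges over, the two parts would share no endpoint, and their strict forest bounds would give at
  least two more endpoints than edges.\<close>

lemma conn_if_card:
  assumes "forest F" "finite F" "F \<noteq> {}" and card: "card (fst ` F) + card (snd ` F) \<le> card F + 1"
  shows "conn F"
proof -
  obtain e where "e \<in> F" using assms by blast
  then have "{e} \<subseteq> F \<and> conn {e}" by (simp add: conn.single)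
  then obtain C where C: "C \<subseteq> F" "conn C" and max: "\<And>D. D \<subseteq> F \<Longrightarrow> conn D \<Longrightarrow> card D \<le> card C"
    using ex_has_greatest_nat[of "\<lambda>C. C \<subseteq> F \<and> conn C" "{e}" card "Suc (card F)"] assms(2)
      card_mono[of F] by (auto simp: less_Suc_eq_le)
  have fin: "finite C" "C \<noteq> {}" using conn_finite[OF C(2)] by auto
  have sep: "fst d \<notin> fst ` C \<and> snd d \<notin> snd ` C" if "d \<in> F - C" for d
  proof (rule ccontr)
    assume "\<not> ?thesis"
    then have "conn (insert d C)" using C conn.grow by blast
    then have "card (insert d C) \<le> card C" using max[of "insert d C"] C that by blast
    then show False using that fin by simp
  qed
  show ?thesis
  proof (cases "F = C")
    case False
    define D where "D = F - C"
    have D: "D \<noteq> {}" "finite D" "F = C \<union> D" "C \<inter> D = {}" using False C assms(2) by (auto simp: D_def)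
    have "card C < card (fst ` C) + card (snd ` C)" "card D < card (fst ` D) + card (snd ` D)"
      using assms(1) C fin D by (auto simp: forest_def)
    moreover have "fst ` C \<inter> fst ` D = {}" "snd ` C \<inter> snd ` D = {}" using sep by (force simp: D_def)+
    then have "card (fst ` F) = card (fst ` C) + card (fst ` D)" "card (snd ` F) = card (snd ` C) + card (snd ` D)"
      using D fin by (simp_all add: image_Un card_Un_disjoint)
    moreover have "card F = card C + card D" using D fin by (simp add: card_Un_disjoint)
    ultimately show ?thesis using card by linarith
  qed (use C in simp)
qed

section \<open>Extension graphs of codes\<close>

definition suffix_code :: "'a list set \<Rightarrow> bool" where
  "suffix_code U \<longleftrightarrow> (\<forall>u\<in>U. \<forall>v\<in>U. suffix u v \<longrightarrow> u = v)"

definition prefix_code :: "'a list set \<Rightarrow> bool" where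
  "prefix_code U \<longleftrightarrow> (\<forall>u\<in>U. \<forall>v\<in>U. prefix u v \<longrightarrow> u = v)"

lemma suffix_code_rev: "suffix_code (rev ` U) \<longleftrightarrow> prefix_code U"
  by (auto simp: suffix_code_def prefix_code_def suffix_to_prefix)

lemma prefix_code_rev: "prefix_code (rev ` U) \<longleftrightarrow> suffix_code U"
  by (auto simp: suffix_code_def prefix_code_def suffix_to_prefix)

lemma suffix_code_subset: "suffix_code U \<Longrightarrow> V \<subseteq> U \<Longrightarrow> suffix_code V"
  by (auto simp: suffix_code_def)

lemma prefix_code_subset: "prefix_code U \<Longrightarrow> V \<subseteq> U \<Longrightarrow> prefix_code V"
  by (auto simp: prefix_code_def)

definition acyclic_set :: "'a list set \<Rightarrow> bool" where
  "acyclic_set S \<longleftrightarrow> factorial_set S \<and> (\<forall>w\<in>S. forest (bi_ext S w))"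

lemma acyclic_set_if_tree_set: "tree_set S \<Longrightarrow> acyclic_set S"
  by (auto simp: tree_set_def acyclic_set_def graph_tree_def ext_graph_edges_def intro!: forest_if_acyclic)

section \<open>Reversal symmetry\<close>

lemma forest_swap:
  assumes "forest E" shows "forest (prod.swap ` E)"
  unfolding forest_def
proof (intro allI impI)
  fix F assume F: "F \<subseteq> prod.swap ` E" "finite F" "F \<noteq> {}"
  then have "prod.swap ` F \<subseteq> E" by auto
  moreover have "card (prod.swap ` F) = card F" by (simp add: card_image)
  moreover have "fst ` prod.swap ` F = snd ` F" "snd ` prod.swap ` F = fst ` F"
    by (simp_all add: image_image)
  ultimately show "card F < card (fst ` F) + card (snd ` F)"
    using assms F by (metis add.commute finite_imageI forest_def image_is_empty)
qed

lemma acyclic_set_rev: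
  assumes "acyclic_set S" shows "acyclic_set (rev ` S)"
proof -
  have mem: "w \<in> rev ` S \<longleftrightarrow> rev w \<in> S" for w by (metis imageE image_eqI rev_rev_ident)
  have "bi_ext (rev ` S) w = prod.swap ` bi_ext S (rev w)" for w
    by (force simp: bi_ext_def mem)
  then show ?thesis
    using assms by (auto simp: acyclic_set_def mem factorial_set_def intro: forest_swap)
qed

lemma acyclic_setD: "acyclic_set S \<Longrightarrow> w \<in> S \<Longrightarrow> sublist u w \<Longrightarrow> u \<in> S"
  by (auto simp: acyclic_set_def factorial_set_def)

text \<open>Reversing words also swaps the two ends of an edge. Suffix codes on the left become
  prefix codes on the right, so a statement about one side yields the one about the other.\<close>

definition mirror :: "('a list \<times> 'a list) set \<Rightarrow> ('a list \<times> 'a list) set" where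
  "mirror F = (\<lambda>(u, v). (rev v, rev u)) ` F"

lemma mirror_simps [simp]:
  "fst ` mirror F = rev ` snd ` F" "snd ` mirror F = rev ` fst ` F"
  "(u, v) \<in> mirror F \<longleftrightarrow> (rev v, rev u) \<in> F" "card (mirror F) = card F"
  "finite (mirror F) \<longleftrightarrow> finite F" "mirror F = {} \<longleftrightarrow> F = {}"
proof -
  have inj: "inj (\<lambda>(u :: 'a list, v :: 'a list). (rev v, rev u))" by (auto simp: inj_def)
  show "fst ` mirror F = rev ` snd ` F" "snd ` mirror F = rev ` fst ` F"
    by (simp_all add: mirror_def image_image case_prod_unfold)
  show "(u, v) \<in> mirror F \<longleftrightarrow> (rev v, rev u) \<in> F"
    by (force simp: mirror_def)
  show "card (mirror F) = card F" "finite (mirror F) \<longleftrightarrow> finite F"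
    using inj by (auto simp: mirror_def intro!: card_image finite_image_iff intro: inj_on_subset)
qed (simp add: mirror_def)

text \<open>A finite part of the extension graph of \<open>w\<close> in which words of a suffix code
  and of a prefix code take the place of left and right letters.\<close>

definition ext_edges :: "'a list set \<Rightarrow> 'a list \<Rightarrow> ('a list \<times> 'a list) set \<Rightarrow> bool" where
  "ext_edges S w F \<longleftrightarrow> acyclic_set S \<and> finite F \<and> F \<noteq> {} \<and>
     suffix_code (fst ` F) \<and> prefix_code (snd ` F) \<and> (\<forall>(u, v)\<in>F. u @ w @ v \<in> S)"

text \<open>Lengths are summed over distinct ends rather than over edges, so that contracting
  several ends to one decreases the sum. It is the induction measure.\<close>

definition total_length :: "('a list \<times> 'a list) set \<Rightarrow> nat" where
  "total_length F = (\<Sum>u\<in>fst ` F. length u) + (\<Sum>v\<in>snd ` F. length v)"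

lemma ext_edges_mirror:
  assumes "ext_edges S w F" shows "ext_edges (rev ` S) (rev w) (mirror F)"
proof -
  have "u @ rev w @ v \<in> rev ` S" if "(u, v) \<in> mirror F" for u v
    using that assms by (force simp: ext_edges_def image_iff intro: bexI[of _ "rev v @ w @ rev u"])
  then show ?thesis
    using assms by (auto simp: ext_edges_def acyclic_set_rev suffix_code_rev prefix_code_rev)
qed

lemma total_length_mirror: "total_length (mirror F) = total_length F"
  by (simp add: total_length_def sum.reindex)

text \<open>Choose \<open>u = a # s\<close> of maximal length among the left ends. The left ends with suffix \<open>s\<close> are then
  all of the form \<open>b # s\<close>, and both the graph in which they are contracted to \<open>s\<close> and the
  graph of their first letters (around \<open>s @ w\<close>) are shorter; their edge counts add up.\<close>

lemma ext_edges_card_step: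
  fixes S :: "'a list set" and w :: "'a list" and F :: "('a list \<times> 'a list) set"
  assumes IH: "\<And>S w (G :: ('a list \<times> 'a list) set). total_length G < total_length F \<Longrightarrow> ext_edges S w G
      \<Longrightarrow> card G < card (fst ` G) + card (snd ` G)"
    and F: "ext_edges S w F" and long: "x \<in> fst ` F" "length x \<ge> 2"
  shows "card F < card (fst ` F) + card (snd ` F)"
proof -
  have fin: "finite F" "finite (fst ` F)" "finite (snd ` F)" using F by (auto simp: ext_edges_def)
  obtain u where u: "u \<in> fst ` F" and max: "\<And>v. v \<in> fst ` F \<Longrightarrow> length v \<le> length u"
    using ex_has_greatest_nat[of "\<lambda>u. u \<in> fst ` F" x length "Suc (\<Sum>u\<in>fst ` F. length u)"] long(1)
      member_le_sum[of _ "fst ` F" length] fin by (metis le_imp_less_Suc le0)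
  obtain a s where as: "u = a # s" "s \<noteq> []"
    using max[OF long(1)] long(2) by (cases u; cases "tl u") auto
  define K where "K = {v \<in> fst ` F. suffix s v}"
  \<comment> \<open>By maximality of \<open>u\<close> at most one letter precedes \<open>s\<close>;
    none is impossible, because \<open>s\<close> is a proper suffix of the left end
    \<open>u\<close>.\<close>
  have K: "\<exists>b. v = b # s" if "v \<in> K" for v
  proof -
    from that obtain t where t: "v = t @ s" by (auto simp: K_def suffix_def)
    with that max[of v] as have "length t \<le> 1" by (auto simp: K_def)
    moreover have "t \<noteq> []"
    proof
      assume "t = []"
      with t that have "s \<in> fst ` F" by (simp add: K_def)
      moreover have "suffix_code (fst ` F)" "suffix s u" using F as by (auto simp: ext_edges_def suffix_ConsI)
      ultimately have "s = u" using u by (auto simp: suffix_code_def)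
      with as show False by simp
    qed
    ultimately show ?thesis using t by (cases t) auto
  qed
  have "u \<in> K" using u as by (simp add: K_def suffix_ConsI)
  have sK: "s \<notin> fst ` F - K" by (auto simp: K_def)
  have KF: "K \<subseteq> fst ` F" by (auto simp: K_def)
  then have finK: "finite K" using fin finite_subset by blast
  have lenK: "(\<Sum>v\<in>K. length v) = card K * (length s + 1)"
  proof -
    have "length v = length s + 1" if "v \<in> K" for v using K[OF that] by auto
    then show ?thesis by simp
  qed
  have "card K > 0" using \<open>u \<in> K\<close> finK by (auto simp: card_gt_0_iff)
  have split: "(\<Sum>v\<in>fst ` F. length v) = (\<Sum>v\<in>fst ` F - K. length v) + (\<Sum>v\<in>K. length v)"
    using sum.subset_diff[OF KF fin(2)] .
  define FK where "FK = {e \<in> F. fst e \<in> K}"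
  have FK: "finite FK" "FK \<noteq> {}" "fst ` FK = K" "snd ` FK \<subseteq> snd ` F"
  proof -
    show fFK: "fst ` FK = K" using KF by (auto simp: FK_def)
    then show "FK \<noteq> {}" using \<open>u \<in> K\<close> by blast
    show "finite FK" "snd ` FK \<subseteq> snd ` F" using fin by (auto simp: FK_def)
  qed
  define G where "G = map_prod (\<lambda>v. [hd v]) id ` FK"
  have injK: "inj_on (\<lambda>v. [hd v]) K" 
  proof (rule inj_onI)
    fix x y assume "x \<in> K" "y \<in> K" "[hd x] = [hd y]"
    then show "x = y" using K[of x] K[of y] by auto
  qed
  have G: "fst ` G = (\<lambda>v. [hd v]) ` K" "snd ` G = snd ` FK" "card G = card FK"
  proof -
    show "fst ` G = (\<lambda>v. [hd v]) ` K" "snd ` G = snd ` FK"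
      using FK(3) by (auto simp: G_def image_image)
    have "inj_on (map_prod (\<lambda>v. [hd v]) id) (K \<times> UNIV)"
      using injK by (intro map_prod_inj_on) auto
    then have "inj_on (map_prod (\<lambda>v. [hd v]) id) FK"
      by (rule inj_on_subset) (auto simp: FK_def)
    then show "card G = card FK" by (simp add: G_def card_image)
  qed
  have "ext_edges S (s @ w) G"
    unfolding ext_edges_def
  proof (intro conjI)
    show "suffix_code (fst ` G)" by (auto simp: G suffix_code_def suffix_Cons)
    show "prefix_code (snd ` G)" using F FK(4) by (auto simp: G ext_edges_def intro: prefix_code_subset)
    show "\<forall>(u, v)\<in>G. u @ (s @ w) @ v \<in> S"
    proof clarify
      fix p v assume "(p, v) \<in> G"
      then obtain y where y: "(y, v) \<in> F" "y \<in> K" "p = [hd y]" by (auto simp: G_def FK_def)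
      then have "y @ w @ v \<in> S" using F by (auto simp: ext_edges_def)
      then show "p @ (s @ w) @ v \<in> S" using y K[of y] by auto
    qed
  qed (use F FK in \<open>auto simp: ext_edges_def G_def\<close>)
  moreover have "total_length G < total_length F"
  proof -
    have "(\<Sum>v\<in>fst ` G. length v) = card K"
      unfolding G by (simp add: sum.reindex[OF injK])
    also have "\<dots> < (\<Sum>v\<in>K. length v)" using lenK \<open>card K > 0\<close> as by simp
    finally have "(\<Sum>v\<in>fst ` G. length v) < (\<Sum>v\<in>fst ` F. length v)" using split by simp
    moreover have "(\<Sum>v\<in>snd ` G. length v) \<le> (\<Sum>v\<in>snd ` F. length v)"
      unfolding G using FK fin by (intro sum_mono2) auto
    ultimately show ?thesis by (simp add: total_length_def)
  qed
  ultimately have "card G < card (fst ` G) + card (snd ` G)" by (rule IH[rotated])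
  then have b1: "card FK < card (fst ` FK) + card (snd ` FK)"
    using G FK(3) card_image[OF injK] by simp
  define F' where "F' = (\<lambda>(u, v). (if u \<in> K then s else u, v)) ` F"
  have cc: "card F' + card FK = card F + card (snd ` FK)"
    "card (fst ` F') + card (fst ` FK) = card (fst ` F) + 1" "snd ` F' = snd ` F"
    using card_contract[of F K s] fin FK(2) sK unfolding F'_def FK_def by blast+
  have fF': "fst ` F' = insert s (fst ` F - K)"
    using \<open>u \<in> K\<close> u by (force simp: F'_def image_image case_prod_unfold)
  have "ext_edges S w F'"
    unfolding ext_edges_def
  proof (intro conjI)
    have "suffix_code (fst ` F)" using F by (simp add: ext_edges_def)
    moreover have "\<not> suffix v s" if "v \<in> fst ` F - K" for v
    proof
      assume "suffix v s"
      then have "suffix v u" by (simp add: as suffix_ConsI)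
      with F u that have "v = u" by (auto simp: ext_edges_def suffix_code_def)
      with that \<open>u \<in> K\<close> show False by simp
    qed
    ultimately show "suffix_code (fst ` F')"
      unfolding fF' by (auto simp: suffix_code_def K_def)
    show "\<forall>(u, v)\<in>F'. u @ w @ v \<in> S"
    proof clarify
      fix p v assume "(p, v) \<in> F'"
      then obtain y where y: "(y, v) \<in> F" "p = (if y \<in> K then s else y)" by (auto simp: F'_def)
      then have "y @ w @ v \<in> S" using F by (auto simp: ext_edges_def)
      moreover have "suffix p y" using y K_def by auto
      then have "sublist (p @ w @ v) (y @ w @ v)" by (auto simp: suffix_def sublist_appendI)
      ultimately show "p @ w @ v \<in> S" using F acyclic_setD by (auto simp: ext_edges_def)
    qed
  qed (use F cc in \<open>auto simp: ext_edges_def F'_def\<close>)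
  moreover have "total_length F' < total_length F"
  proof -
    have "(\<Sum>v\<in>fst ` F'. length v) \<le> length s + (\<Sum>v\<in>fst ` F - K. length v)"
      unfolding fF' using fin sK by simp
    also have "\<dots> < (\<Sum>v\<in>fst ` F. length v)" using split lenK \<open>card K > 0\<close> by (cases "card K") auto
    finally show ?thesis using cc by (simp add: total_length_def)
  qed
  ultimately have "card F' < card (fst ` F') + card (snd ` F')" by (rule IH[rotated])
  \<comment> \<open>Each of the two strict bounds gains one unit, and the additional vertex of the
    contraction uses up only one of them.\<close>
  then show ?thesis using b1 cc(1,2) unfolding cc(3) by linarith
qed

text \<open>Acyclicity passes from letters to codes. Ends of two or more letters are shortened by
  contraction, on the right through the mirror; what remains are stars and subgraphs of
  \<open>bi_ext S w\<close>.\<close>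

lemma ext_edges_card:
  "ext_edges S w F \<Longrightarrow> card F < card (fst ` F) + card (snd ` F)"
proof (induction "total_length F" arbitrary: S w F rule: less_induct)
  case less
  note F = less.prems
  have fin: "finite F" "F \<noteq> {}" using F by (auto simp: ext_edges_def)
  show ?case
  proof (cases "\<exists>u\<in>fst ` F. length u \<ge> 2")
    case True
    then obtain x where "x \<in> fst ` F" "length x \<ge> 2" by blast
    with less.hyps F show ?thesis by (rule ext_edges_card_step)
  next
    case short_fst: False
    show ?thesis
    proof (cases "\<exists>v\<in>snd ` F. length v \<ge> 2")
      case True
      then obtain x where "x \<in> fst ` mirror F" "length x \<ge> 2" by fastforce
      with less.hyps[folded total_length_mirror[of F]] ext_edges_mirror[OF F]
      have "card (mirror F) < card (fst ` mirror F) + card (snd ` mirror F)"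
        by (rule ext_edges_card_step)
      then show ?thesis by (simp add: card_image)
    next
      case short_snd: False
      show ?thesis
      \<comment> \<open>The empty word is a prefix and a suffix of every word, so a code containing
        it has no other element and the graph is a star.\<close>
      proof (cases "[] \<in> fst ` F \<or> [] \<in> snd ` F")
        case True
        moreover have "fst ` F \<subseteq> {[]}" if "[] \<in> fst ` F"
          using that F unfolding ext_edges_def suffix_code_def by (metis singletonI subsetI suffix_bot.bot_least)
        moreover have "snd ` F \<subseteq> {[]}" if "[] \<in> snd ` F"
          using that F unfolding ext_edges_def prefix_code_def by (metis singletonI subsetI Nil_prefix)
        ultimately have "fst ` F = {[]} \<or> snd ` F = {[]}" by blast
        then show ?thesis using card_lt_if_singleton_side[OF fin] by auto
      next
        case False
        have e: "\<exists>a b. e = ([a], [b])" if "e \<in> F" for e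
        proof -
          have "fst e \<in> fst ` F" "snd e \<in> snd ` F" using that by auto
          with False short_fst short_snd have "fst e \<noteq> []" "snd e \<noteq> []" "length (fst e) < 2" "length (snd e) < 2"
            by (metis not_less)+
          then show ?thesis by (cases e; cases "fst e"; cases "snd e") auto
        qed
        define H where "H = map_prod hd hd ` F"
        have FH: "F = map_prod (\<lambda>a. [a]) (\<lambda>a. [a]) ` H"
          unfolding H_def image_image using e by force
        have cF: "card F = card H"
          unfolding FH by (rule card_image) (auto simp: inj_on_def)
        have "fst ` F = (\<lambda>a. [a]) ` fst ` H" "snd ` F = (\<lambda>a. [a]) ` snd ` H"
          unfolding FH by (simp_all add: image_image)
        then have cs: "card (fst ` F) = card (fst ` H)" "card (snd ` F) = card (snd ` H)"
          by (simp_all add: card_image inj_on_def)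
        have sub: "H \<subseteq> bi_ext S w"
        proof
          fix h assume "h \<in> H"
          then have "([fst h], [snd h]) \<in> F" unfolding FH by (force simp: map_prod_def case_prod_unfold)
          then show "h \<in> bi_ext S w" using F by (cases h) (auto simp: ext_edges_def bi_ext_def)
        qed
        obtain a b where "(a, b) \<in> H" using fin H_def by auto
        with sub have "a # w @ [b] \<in> S" by (auto simp: bi_ext_def)
        moreover have "sublist w (a # w @ [b])" using sublist_appendI[of w "[a]" "[b]"] by simp
        ultimately have "w \<in> S" using F acyclic_setD by (auto simp: ext_edges_def)
        then have "forest (bi_ext S w)" using F by (auto simp: ext_edges_def acyclic_set_def)
        then show ?thesis using sub fin cF cs by (auto simp: forest_def H_def)
      qed
    qed
  qed
qed

section \<open>The automaton of a bifix code in an acyclic set\<close>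

definition incidence :: "'a list set \<Rightarrow> ('a list \<times> 'a list) set" where
  "incidence X = {(p, q). p \<noteq> [] \<and> q \<noteq> [] \<and> p @ q \<in> X}"

lemma incidence_iff [simp]: "(p, q) \<in> incidence X \<longleftrightarrow> p \<noteq> [] \<and> q \<noteq> [] \<and> p @ q \<in> X"
  by (simp add: incidence_def)

lemma conn_mirror: "conn F \<Longrightarrow> conn (mirror F)"
proof (induction rule: conn.induct)
  case (single e)
  then show ?case by (cases e) (simp add: mirror_def conn.single)
next
  case (grow F e)
  have "mirror (insert e F) = insert (rev (snd e), rev (fst e)) (mirror F)"
    by (simp add: mirror_def case_prod_unfold)
  then show ?case using grow conn.grow[OF grow.IH, of "(rev (snd e), rev (fst e))"] by auto
qed

lemma mirror_mirror [simp]: "mirror (mirror F) = F"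
  by (simp add: mirror_def image_image case_prod_unfold)

lemma mirror_incidence: "mirror (incidence X) = incidence (rev ` X)"
proof -
  have "rev p @ rev q \<in> X \<longleftrightarrow> q @ p \<in> rev ` X" for p q
    by (metis image_iff rev_append rev_rev_ident)
  then show ?thesis by (auto simp: set_eq_iff)
qed

lemma mirror_mono: "F \<subseteq> G \<Longrightarrow> mirror F \<subseteq> mirror G"
  by (auto simp: mirror_def)

text \<open>On the left ends of \<open>incidence X\<close> this is membership in the same connected
  component; the reflexive closure makes it an equivalence on all words.\<close>

definition prefix_rel :: "'a list set \<Rightarrow> ('a list \<times> 'a list) set" where
  "prefix_rel X = {(p, p'). \<exists>q. (p, q) \<in> incidence X \<and> (p', q) \<in> incidence X}\<^sup>*"

lemma prefix_rel_refl: "(p, p) \<in> prefix_rel X"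
  by (simp add: prefix_rel_def)

lemma prefix_rel_trans: "(p, q) \<in> prefix_rel X \<Longrightarrow> (q, r) \<in> prefix_rel X \<Longrightarrow> (p, r) \<in> prefix_rel X"
  by (auto simp: prefix_rel_def)

lemma prefix_rel_sym: "(p, q) \<in> prefix_rel X \<Longrightarrow> (q, p) \<in> prefix_rel X"
  unfolding prefix_rel_def by (rule symD[OF sym_rtrancl]) (auto simp: sym_def)

lemma prefix_rel_step: "(p, q) \<in> incidence X \<Longrightarrow> (p', q) \<in> incidence X \<Longrightarrow> (p, p') \<in> prefix_rel X"
  unfolding prefix_rel_def by blast

lemma prefix_rel_if_conn:
  "conn F \<Longrightarrow> F \<subseteq> incidence X \<Longrightarrow> e \<in> F \<Longrightarrow> e' \<in> F \<Longrightarrow> (fst e, fst e') \<in> prefix_rel X"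
proof (induction arbitrary: e e' rule: conn.induct)
  case (grow F d)
  obtain f where f: "f \<in> F" "fst d = fst f \<or> snd d = snd f" using grow.hyps(2) by auto
  then have "(fst d, fst f) \<in> prefix_rel X"
    using prefix_rel_step[of "fst d" "snd d" X "fst f"] grow.prems(1) f(1)
    by (cases d; cases f) (auto simp: prefix_rel_refl)
  then have "(fst d, fst e) \<in> prefix_rel X" if "e \<in> F" for e
    using grow.IH[OF _ f(1) that] grow.prems(1) prefix_rel_trans by blast
  moreover have "F \<subseteq> incidence X" using grow.prems(1) by blast
  ultimately show ?case
    using grow.prems(2,3) grow.IH prefix_rel_refl prefix_rel_sym by (metis insertE)
qed (auto simp: prefix_rel_refl)

text \<open>Edge counts need finite connected edge sets, so a chain of related prefixes is turned
  into one that contains the two given edges.\<close>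

lemma conn_if_prefix_rel:
  assumes "(p, p') \<in> prefix_rel X" "(p, q) \<in> incidence X" "(p', q') \<in> incidence X"
  shows "\<exists>F. conn F \<and> F \<subseteq> incidence X \<and> (p, q) \<in> F \<and> (p', q') \<in> F"
proof -
  have "\<exists>F. conn F \<and> F \<subseteq> incidence X \<and> (p, q) \<in> F \<and> p' \<in> fst ` F"
    using assms(1) unfolding prefix_rel_def
  proof (induction rule: rtrancl_induct)
    case base
    show ?case using conn.single[of "(p, q)"] assms(2) by (intro exI[of _ "{(p, q)}"]) auto
  next
    case (step y z)
    then obtain F where F: "conn F" "F \<subseteq> incidence X" "(p, q) \<in> F" "y \<in> fst ` F" by blast
    from step obtain r where r: "(y, r) \<in> incidence X" "(z, r) \<in> incidence X" by blast
    have "conn (insert (z, r) (insert (y, r) F))"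
      by (rule conn.grow, rule conn.grow) (use F in auto)
    then show ?case
      using F r by (intro exI[of _ "insert (z, r) (insert (y, r) F)"]) auto
  qed
  then obtain F where F: "conn F" "F \<subseteq> incidence X" "(p, q) \<in> F" "p' \<in> fst ` F" by blast
  then have "conn (insert (p', q') F)" by (intro conn.grow) auto
  then show ?thesis
    using F assms by (intro exI[of _ "insert (p', q') F"]) auto
qed

section \<open>Connected factorisation graphs of a bifix code\<close>

locale bifix_acyclic =
  fixes S X :: "'a list set"
  assumes acyclic: "acyclic_set S" and sub: "X \<subseteq> S"
    and pre: "prefix_code X" and suf: "suffix_code X" and nonempty: "[] \<notin> X"
begin

lemma rev_bifix_acyclic: "bifix_acyclic (rev ` S) (rev ` X)"
  by (standard) (use acyclic sub pre suf nonempty in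
    \<open>auto simp: acyclic_set_rev suffix_code_rev prefix_code_rev\<close>)

lemma factor_mem: "sublist u x \<Longrightarrow> x \<in> X \<Longrightarrow> u \<in> S"
  using acyclic_setD[OF acyclic] sub by blast

lemma incidence_mem: "e \<in> incidence X \<Longrightarrow> fst e @ snd e \<in> S"
  using sub by (auto simp: incidence_def)

lemma suffix_incidence_mem:
  assumes "(u, v) \<in> incidence X" "suffix p u" shows "p @ v \<in> S"
proof -
  obtain t where "u = t @ p" using assms(2) by (auto simp: suffix_def)
  then have "sublist (p @ v) (u @ v)" by (metis append.assoc append_Nil2 sublist_appendI)
  then show ?thesis using assms(1) factor_mem by auto
qed

text \<open>If \<open>p'\<close> were suffix-comparable to a left end, contracting left ends to the shorter of the two
  would add one more edge to a connected graph without new vertices, so that edge is present already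
  and \<open>X\<close> is not a suffix code.\<close>

lemma suffix_code_insert:
  assumes F: "conn F" "F \<subseteq> incidence X" "suffix_code (fst ` F)" "prefix_code (snd ` F)"
    and v: "v \<in> snd ` F" and new: "(p', v) \<in> incidence X"
  shows "suffix_code (insert p' (fst ` F))"
proof -
  have fin: "finite F" "F \<noteq> {}" using conn_finite F by auto
  have a: "p = p'" if p: "p \<in> fst ` F" "suffix p p'" for p
  proof -
    define G where "G = insert (p, v) F"
    have G: "fst ` G = fst ` F" "snd ` G = snd ` F" using p v by (auto simp: G_def)
    have "p @ v \<in> S"
      using that new suffix_incidence_mem by blast
    then have "ext_edges S [] G"
      unfolding ext_edges_def G using F fin acyclic incidence_mem by (auto simp: G_def subset_iff)
    then have "card G < card (fst ` F) + card (snd ` F)" using ext_edges_card G by metis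
    also have "\<dots> \<le> card F + 1" by (rule conn_card[OF F(1)])
    finally have "(p, v) \<in> F" using fin by (auto simp: G_def card_insert_if split: if_splits)
    then have "p @ v \<in> X" "p' @ v \<in> X" using F new by auto
    moreover have "suffix (p @ v) (p' @ v)" using p by (auto simp: suffix_def)
    ultimately have "p @ v = p' @ v" using suf unfolding suffix_code_def by blast
    then show ?thesis by simp
  qed
  have b: "p = p'" if p: "p \<in> fst ` F" "suffix p' p" for p
  proof -
    define f where "f u = (if suffix p' u then p' else u)" for u
    define F1 where "F1 = map_prod f id ` F"
    have F1: "conn F1" "fst ` F1 = f ` fst ` F" "snd ` F1 = snd ` F"
      by (simp_all add: F1_def conn_map_prod F image_image)
    define G where "G = insert (p', v) F1"
    have "p' \<in> f ` fst ` F" using p by (auto simp: f_def intro!: image_eqI[of _ _ p])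
    then have G: "fst ` G = f ` fst ` F" "snd ` G = snd ` F" using v F1 by (auto simp: G_def)
    have "suffix_code (f ` fst ` F)"
      unfolding suffix_code_def
    proof (intro ballI impI)
      fix x y assume "x \<in> f ` fst ` F" "y \<in> f ` fst ` F" and xy: "suffix x y"
      then obtain u v where uv: "u \<in> fst ` F" "v \<in> fst ` F" "x = f u" "y = f v" by blast
      have eq: "u = v" if "suffix u v" using that uv(1,2) F(3) unfolding suffix_code_def by blast
      show "x = y"
      proof (cases "suffix p' u")
        case True
        then have "suffix p' y" using xy uv(3) by (simp add: f_def)
        then have "suffix p' v" using uv(4) by (auto simp: f_def split: if_splits)
        then show ?thesis using True uv(3,4) by (simp add: f_def)
      next
        case False
        then have "x = u" using uv(3) by (simp add: f_def)
        moreover have "suffix y v" using uv(4) by (simp add: f_def)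
        ultimately have "u = v" using xy eq suffix_order.trans by blast
        then show ?thesis using uv(3,4) by simp
      qed
    qed
    moreover have "f u @ v \<in> S" if "(u, v) \<in> F" for u v
      using that F(2) suffix_incidence_mem[of u v "f u"] by (auto simp: f_def)
    moreover have "p' @ v \<in> S" using new sub by auto
    ultimately have "ext_edges S [] G"
      unfolding ext_edges_def G using F(4) fin acyclic by (auto simp: G_def F1_def)
    then have "card G < card (fst ` F1) + card (snd ` F1)" using ext_edges_card G F1 by metis
    also have "\<dots> \<le> card F1 + 1" by (rule conn_card[OF F1(1)])
    finally have "(p', v) \<in> F1" using fin by (auto simp: G_def F1_def card_insert_if split: if_splits)
    then obtain u where u: "(u, v) \<in> F" "f u = p'" by (auto simp: F1_def)
    then have su: "suffix p' u" by (auto simp: f_def split: if_splits)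
    then have "suffix (p' @ v) (u @ v)" by (auto simp: suffix_def)
    moreover have "u @ v \<in> X" "p' @ v \<in> X" using F u new by auto
    ultimately have "p' @ v = u @ v" using suf unfolding suffix_code_def by blast
    then have "u = p'" by simp
    then have "p' \<in> fst ` F" using u by force
    with p F(3) show ?thesis unfolding suffix_code_def by metis
  qed
  show ?thesis using a b F(3) unfolding suffix_code_def by blast
qed

text \<open>Reversal of all words turns this into \<open>suffix_code_insert\<close>.\<close>

lemma prefix_code_insert:
  assumes F: "conn F" "F \<subseteq> incidence X" "suffix_code (fst ` F)" "prefix_code (snd ` F)"
    and u: "u \<in> fst ` F" and new: "(u, q) \<in> incidence X"
  shows "prefix_code (insert q (snd ` F))"
proof -
  have "suffix_code (insert (rev q) (fst ` mirror F))"
  proof (rule bifix_acyclic.suffix_code_insert[OF rev_bifix_acyclic])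
    show "mirror F \<subseteq> incidence (rev ` X)" using F(2) mirror_mono mirror_incidence by metis
    have "(rev q, rev u) \<in> mirror (incidence X)" using new by simp
    then show "(rev q, rev u) \<in> incidence (rev ` X)" by (simp only: mirror_incidence)
  qed (use F u in \<open>simp_all add: conn_mirror suffix_code_rev prefix_code_rev\<close>)
  then have "suffix_code (rev ` insert q (snd ` F))" by simp
  then show ?thesis by (simp only: suffix_code_rev)
qed

text \<open>An edge attached to a connected set brings a new word on at most one side, which is the
  situation of the two insertion lemmas.\<close>

lemma conn_codes:
  "conn F \<Longrightarrow> F \<subseteq> incidence X \<Longrightarrow> suffix_code (fst ` F) \<and> prefix_code (snd ` F)"
proof (induction rule: conn.induct)
  case (single e)
  then show ?case by (simp add: suffix_code_def prefix_code_def)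
next
  case (grow F e)
  then have IH: "suffix_code (fst ` F)" "prefix_code (snd ` F)" and F: "F \<subseteq> incidence X"
    and e: "(fst e, snd e) \<in> incidence X" by auto
  show ?case
  proof (cases "fst e \<in> fst ` F")
    case True
    then show ?thesis
      using prefix_code_insert[OF grow.hyps(1) F IH _ e] IH by (simp add: insert_absorb)
  next
    case False
    with grow.hyps(2) have "snd e \<in> snd ` F" by blast
    then show ?thesis
      using suffix_code_insert[OF grow.hyps(1) F IH _ e] IH by (simp add: insert_absorb)
  qed
qed

text \<open>Contracting the left ends with last letter \<open>a\<close> to \<open>[a]\<close> again gives a forest; comparing edge
  counts, the contracted part \<open>FK\<close> has one vertex more than edges, so it is connected on its own.\<close>

lemma conn_butlast:
  assumes F: "conn F" "F \<subseteq> incidence X" and a: "[a] \<notin> fst ` F"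
  defines "FK \<equiv> {e \<in> F. suffix [a] (fst e)}"
  assumes "FK \<noteq> {}"
  shows "conn (map_prod butlast ((#) a) ` FK)" "map_prod butlast ((#) a) ` FK \<subseteq> incidence X"
proof -
  have codes: "suffix_code (fst ` F)" "prefix_code (snd ` F)" using conn_codes F by auto
  have fin: "finite F" "F \<noteq> {}" using conn_finite F by auto
  have bound: "card G < card (fst ` G) + card (snd ` G)" if "G \<subseteq> F" "finite G" "G \<noteq> {}" for G
  proof (rule ext_edges_card)
    have "u @ v \<in> S" if "(u, v) \<in> G" for u v
      using that \<open>G \<subseteq> F\<close> F(2) incidence_mem[of "(u, v)"] by auto
    moreover have "suffix_code (fst ` G)" "prefix_code (snd ` G)"
      using codes \<open>G \<subseteq> F\<close> by (meson image_mono suffix_code_subset prefix_code_subset)+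
    ultimately show "ext_edges S [] G"
      using that acyclic by (auto simp: ext_edges_def)
  qed
  define K where "K = {u. suffix [a] u}"
  define F' where "F' = (\<lambda>(u, v). (if u \<in> K then [a] else u, v)) ` F"
  have FK': "FK = {e \<in> F. fst e \<in> K}" by (simp add: FK_def K_def)
  have cc: "card F' + card FK = card F + card (snd ` FK)"
    "card (fst ` F') + card (fst ` FK) = card (fst ` F) + 1" "snd ` F' = snd ` F"
    using card_contract[of F K "[a]"] fin(1) \<open>FK \<noteq> {}\<close> a unfolding F'_def FK' by auto
  have "ext_edges S [] F'"
    unfolding ext_edges_def
  proof (intro conjI)
    have "fst ` F' \<subseteq> insert [a] (fst ` F - K)"
      by (auto simp: F'_def intro: rev_image_eqI split: if_splits)
    moreover have "suffix_code (insert [a] (fst ` F - K))"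
    proof -
      have "[] \<notin> fst ` F" using F(2) by auto
      then show ?thesis using codes(1) by (auto simp: suffix_code_def K_def suffix_Cons)
    qed
    ultimately show "suffix_code (fst ` F')" by (rule suffix_code_subset[rotated])
    have "(if u \<in> K then [a] else u) @ v \<in> S" if "(u, v) \<in> F" for u v
    proof -
      have "suffix (if u \<in> K then [a] else u) u" by (simp add: K_def)
      then show ?thesis using that F(2) suffix_incidence_mem by blast
    qed
    then show "\<forall>(u, v)\<in>F'. u @ [] @ v \<in> S" by (auto simp: F'_def)
  qed (use fin codes acyclic cc in \<open>auto simp: F'_def\<close>)
  then have "card F' < card (fst ` F') + card (snd ` F)" using ext_edges_card cc(3) by metis
  then have "card (fst ` FK) + card (snd ` FK) \<le> card FK + 1"
    using cc(1,2) conn_card[OF F(1)] by linarith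
  then have "conn FK"
    using conn_if_card[of FK] bound \<open>FK \<noteq> {}\<close> fin by (auto simp: forest_def FK_def)
  then show "conn (map_prod butlast ((#) a) ` FK)" by (rule conn_map_prod)
  show "map_prod butlast ((#) a) ` FK \<subseteq> incidence X"
  proof
    fix e assume "e \<in> map_prod butlast ((#) a) ` FK"
    then obtain s q where e: "e = (s, a # q)" "(s @ [a], q) \<in> F" by (auto simp: FK_def suffix_def)
    \<comment> \<open>Moving \<open>a\<close> across the cut keeps the word
      \<open>s @ a # q\<close>; the left end stays nonempty because \<open>[a]\<close> is not a left
      end of \<open>F\<close>.\<close>
    then have "s \<noteq> []" using a by force
    then show "e \<in> incidence X" using e F(2) by auto
  qed
qed

section \<open>States and determinism of the automaton\<close>

definition state :: "'a list \<Rightarrow> 'a list set" where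
  "state p = (if p = [] \<or> p \<in> X then {} else prefix_rel X `` {p})"

text \<open>Every class contains its representative, so the empty set is free to serve as the common
  state of the empty word and the words of \<open>X\<close>.\<close>

lemma state_empty_iff: "state p = {} \<longleftrightarrow> p = [] \<or> p \<in> X"
  using prefix_rel_refl by (auto simp: state_def)

lemma state_eq_emptyD: "state p = state p' \<Longrightarrow> p = [] \<or> p \<in> X \<Longrightarrow> p' = [] \<or> p' \<in> X"
  using state_empty_iff by blast

lemma state_eq_iff:
  assumes "p \<noteq> []" "p \<notin> X" "p' \<noteq> []" "p' \<notin> X"
  shows "state p = state p' \<longleftrightarrow> (p, p') \<in> prefix_rel X"
proof
  assume "state p = state p'"
  then have "prefix_rel X `` {p} = prefix_rel X `` {p'}" using assms by (simp add: state_def)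
  moreover have "p' \<in> prefix_rel X `` {p'}" by (simp add: prefix_rel_refl)
  ultimately show "(p, p') \<in> prefix_rel X" by blast
next
  assume pp: "(p, p') \<in> prefix_rel X"
  have "(p, q) \<in> prefix_rel X \<longleftrightarrow> (p', q) \<in> prefix_rel X" for q
    using prefix_rel_trans[OF pp] prefix_rel_trans[OF prefix_rel_sym[OF pp]] by blast
  then show "state p = state p'" using assms by (auto simp: state_def)
qed

lemma proper_prefix_notin: "p @ q \<in> X \<Longrightarrow> q \<noteq> [] \<Longrightarrow> p \<notin> X"
  using pre by (force simp: prefix_code_def)

text \<open>Outside \<open>X\<close>, a connected edge set joins the two extended prefixes. If
  \<open>[a]\<close> is not a left end, its edges with left end closing in \<open>a\<close> stay
  connected when \<open>a\<close> moves to the right, which joins \<open>p1\<close> to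
  \<open>p2\<close>; if it is, the suffix code makes both prefixes empty.\<close>

lemma state_codeterministic:
  assumes x: "p1 @ a # z1 \<in> X" "p2 @ a # z2 \<in> X" and st: "state (p1 @ [a]) = state (p2 @ [a])"
  shows "state p1 = state p2"
proof -
  have nX: "p1 \<notin> X" "p2 \<notin> X" using x by (auto dest: proper_prefix_notin)
  show ?thesis
  proof (cases "p1 @ [a] \<in> X")
    case True
    then have "p2 @ [a] \<in> X"
      using state_eq_emptyD[OF st] by blast
    \<comment> \<open>If one of them is empty, then \<open>[a]\<close> is in \<open>X\<close>, is a
      suffix of the other word of \<open>X\<close>, and hence equals it.\<close>
    moreover have "p1 = [] \<longleftrightarrow> p2 = []"
    proof -
      have "suffix [a] (p @ [a])" for p by (simp add: suffix_def)
      then show ?thesis using suf True calculation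
        unfolding suffix_code_def by (metis append_Nil self_append_conv2)
    qed
    \<comment> \<open>Nonempty \<open>p1\<close> and \<open>p2\<close> share the completion
      \<open>[a]\<close>.\<close>
    ultimately show ?thesis
      using True nX state_eq_iff prefix_rel_step[of p1 "[a]" X p2] by (cases "p1 = []") auto
  next
    case False
    then have n: "p2 @ [a] \<notin> X"
      using state_eq_emptyD[OF st[symmetric]] by blast
    then have z: "z1 \<noteq> []" "z2 \<noteq> []" using x False by auto
    have "(p1 @ [a], p2 @ [a]) \<in> prefix_rel X" using st False n state_eq_iff by blast
    then obtain F where F: "conn F" "F \<subseteq> incidence X" "(p1 @ [a], z1) \<in> F" "(p2 @ [a], z2) \<in> F"
      using conn_if_prefix_rel[of "p1 @ [a]" "p2 @ [a]" X z1 z2] x z by auto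
    then have mem: "p1 @ [a] \<in> fst ` F" "p2 @ [a] \<in> fst ` F" by force+
    show ?thesis
    proof (cases "[a] \<in> fst ` F")
      case True
      then have "p1 = [] \<and> p2 = []"
      proof -
        have "suffix [a] (p @ [a])" for p by (simp add: suffix_def)
        then show ?thesis using conn_codes[OF F(1,2)] True mem
          unfolding suffix_code_def by (metis append_Nil self_append_conv2)
      qed
      then show ?thesis by simp
    next
      case False
      define FK where "FK = {e \<in> F. suffix [a] (fst e)}"
      have FK: "(p1 @ [a], z1) \<in> FK" "(p2 @ [a], z2) \<in> FK" using F by (auto simp: FK_def suffix_def)
      then have "FK \<noteq> {}" by blast
      note cb = conn_butlast[OF F(1,2) False, folded FK_def, OF this]
      have "(fst (p1, a # z1), fst (p2, a # z2)) \<in> prefix_rel X"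
        by (rule prefix_rel_if_conn[OF cb])
          (rule rev_image_eqI[OF FK(1)], simp, rule rev_image_eqI[OF FK(2)], simp)
      moreover have "p1 \<noteq> []" "p2 \<noteq> []" using False mem by (metis append_Nil)+
      ultimately show ?thesis using nX state_eq_iff[of p1 p2] by simp
    qed
  qed
qed

text \<open>The argument of \<open>state_codeterministic\<close> seen in the mirror: right ends
  beginning with \<open>a\<close> become left ends closing in \<open>a\<close>. Edge sets are
  reversed instead of states, because states are built from prefixes only.\<close>

lemma state_deterministic:
  assumes x: "p1 @ a # z1 \<in> X" "p2 @ a # z2 \<in> X" and st: "state p1 = state p2"
  shows "state (p1 @ [a]) = state (p2 @ [a])"
proof -
  have nX: "p1 \<notin> X" "p2 \<notin> X" using x by (auto dest: proper_prefix_notin)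
  show ?thesis
  proof (cases "p1 = []")
    case True
    then have "p2 = []" using state_eq_emptyD[OF st] nX by blast
    with True show ?thesis by simp
  next
    case False
    then have n: "p2 \<noteq> []" using state_eq_emptyD[OF st[symmetric]] nX by blast
    have "(p1, p2) \<in> prefix_rel X" using st False n nX state_eq_iff by blast
    then obtain F where F: "conn F" "F \<subseteq> incidence X" "(p1, a # z1) \<in> F" "(p2, a # z2) \<in> F"
      using conn_if_prefix_rel[of p1 p2 X "a # z1" "a # z2"] x False n by auto
    then have mem: "a # z1 \<in> snd ` F" "a # z2 \<in> snd ` F" by force+
    show ?thesis
    proof (cases "[a] \<in> snd ` F")
      case True
      then have "z1 = [] \<and> z2 = []"
      proof -
        have "prefix [a] (a # z)" for z by simp
        then show ?thesis using conn_codes[OF F(1,2)] True mem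
          unfolding prefix_code_def by (metis list.inject)
      qed
      \<comment> \<open>Both extended prefixes are now words of \<open>X\<close>.\<close>
      then show ?thesis using x by (simp add: state_def)
    next
      case False
      define FK where "FK = {e \<in> mirror F. suffix [a] (fst e)}"
      have FK: "(rev z1 @ [a], rev p1) \<in> FK" "(rev z2 @ [a], rev p2) \<in> FK"
        using F by (auto simp: FK_def suffix_def)
      then have "FK \<noteq> {}" by blast
      have sub': "mirror F \<subseteq> incidence (rev ` X)"
        using mirror_mono[OF F(2)] by (simp only: mirror_incidence)
      have a: "[a] \<notin> fst ` mirror F" using False by force
      note cb = bifix_acyclic.conn_butlast[OF rev_bifix_acyclic conn_mirror[OF F(1)] sub' a,
          folded FK_def, OF \<open>FK \<noteq> {}\<close>]
      define G where "G = mirror (map_prod butlast ((#) a) ` FK)"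
      have G: "conn G" "G \<subseteq> incidence X"
        using conn_mirror[OF cb(1)] mirror_mono[OF cb(2)]
        by (simp_all add: G_def mirror_incidence image_image)
      have "(rev z1, a # rev p1) \<in> map_prod butlast ((#) a) ` FK"
        "(rev z2, a # rev p2) \<in> map_prod butlast ((#) a) ` FK"
        by (rule rev_image_eqI[OF FK(1)], simp) (rule rev_image_eqI[OF FK(2)], simp)
      then have "(p1 @ [a], z1) \<in> G" "(p2 @ [a], z2) \<in> G" by (simp_all add: G_def)
      then have "(p1 @ [a], p2 @ [a]) \<in> prefix_rel X" using prefix_rel_if_conn[OF G, of "(p1 @ [a], z1)" "(p2 @ [a], z2)"] by simp
      moreover have "z1 \<noteq> []" "z2 \<noteq> []" using mem False by auto
      then have "p1 @ [a] \<notin> X" "p2 @ [a] \<notin> X"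
        using x proper_prefix_notin[of "p1 @ [a]" z1] proper_prefix_notin[of "p2 @ [a]" z2] by auto
      ultimately show ?thesis using state_eq_iff[of "p1 @ [a]" "p2 @ [a]"] by simp
    qed
  qed
qed

end

section \<open>Loops of the automaton\<close>

lemma FG_mult: "u \<otimes>\<^bsub>FG\<^esub> v = foldr cons_red u v"
  and FG_one: "\<one>\<^bsub>FG\<^esub> = []"
  and FG_carrier: "w \<in> carrier FG \<longleftrightarrow> reduced w"
  by (simp_all add: free_group_def)

lemma FG_inv:
  assumes "w \<in> carrier FG"
  shows "inv\<^bsub>FG\<^esub> w = foldr cons_red (rev (map inv_letter w)) []"
proof -
  interpret group FG by (rule group_free_group)
  show ?thesis
  proof (rule inv_equality)
    show "foldr cons_red (rev (map inv_letter w)) [] \<otimes>\<^bsub>FG\<^esub> w = \<one>\<^bsub>FG\<^esub>"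
      using assms foldr_cons_red_inverse[of "[]" w]
      by (simp add: FG_mult FG_one FG_carrier foldr_cons_red_assoc foldr_cons_red_Nil)
  qed (use assms in \<open>simp_all add: FG_carrier reduced_foldr_cons_red\<close>)
qed

context bifix_acyclic
begin

definition edge :: "'a list set \<Rightarrow> 'a \<Rightarrow> 'a list set \<Rightarrow> bool" where
  "edge s a t \<longleftrightarrow> (\<exists>p z. p @ a # z \<in> X \<and> s = state p \<and> t = state (p @ [a]))"

fun run :: "'a list set \<Rightarrow> ('a \<times> bool) list \<Rightarrow> 'a list set \<Rightarrow> bool" where
  "run s [] t \<longleftrightarrow> s = t"
| "run s ((a, b) # w) t \<longleftrightarrow> (\<exists>r. (if b then edge s a r else edge r a s) \<and> run r w t)"

lemma edge_unique: "edge s a t \<Longrightarrow> edge s a t' \<Longrightarrow> t = t'"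
  unfolding edge_def using state_deterministic by blast

lemma edge_unique_source: "edge s a t \<Longrightarrow> edge s' a t \<Longrightarrow> s = s'"
  unfolding edge_def using state_codeterministic by blast

lemma run_append: "run s (u @ v) t \<longleftrightarrow> (\<exists>r. run s u r \<and> run r v t)"
  by (induction s u t rule: run.induct) auto

lemma run_cons_red:
  assumes "run s (l # w) t" shows "run s (cons_red l w) t"
proof (cases "\<exists>w'. w = inv_letter l # w'")
  case True
  then obtain w' where w: "w = inv_letter l # w'" by blast
  obtain a b where l: "l = (a, b)" by (cases l)
  obtain r r' where r: "if b then edge s a r else edge r a s" "if b then edge r' a r else edge r a r'" "run r' w' t"
    using assms by (cases b) (auto simp: w l inv_letter_def)
  then have "s = r'" using edge_unique edge_unique_source by (metis (full_types))
  then show ?thesis using r by (simp add: w)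
next
  case False
  then have "cons_red l w = l # w" by (cases w) auto
  with assms show ?thesis by simp
qed

lemma run_foldr_cons_red: "run s (u @ v) t \<Longrightarrow> run s (foldr cons_red u v) t"
proof (induction u arbitrary: s)
  case (Cons l u)
  then have "run s (l # foldr cons_red u v) t" by (cases l) auto
  then show ?case by (simp add: run_cons_red)
qed simp

lemma run_inverse: "run s w t \<Longrightarrow> run t (rev (map inv_letter w)) s"
proof (induction s w t rule: run.induct)
  case (2 s a b w t)
  then show ?case by (cases b) (auto simp: run_append inv_letter_def)
qed simp

lemma run_of_word: "p @ w \<in> X \<Longrightarrow> run (state p) (of_word w) (state (p @ w))"
proof (induction w arbitrary: p)
  case (Cons a w)
  then have "edge (state p) a (state (p @ [a]))" by (auto simp: edge_def)
  moreover have "run (state (p @ [a])) (of_word w) (state ((p @ [a]) @ w))"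
    using Cons.prems by (intro Cons.IH) simp
  ultimately show ?case by (auto simp: of_word_def)
qed (simp add: of_word_def)

lemma run_word: "x \<in> X \<Longrightarrow> run {} (of_word x) {}"
  using run_of_word[of "[]" x] by (simp add: state_def)

text \<open>Loops at the state \<open>{}\<close> are closed under concatenation and inversion, and
  free reduction preserves them.\<close>

lemma run_generate: "w \<in> generate FG (of_word ` X) \<Longrightarrow> run {} w {}"
proof (induction rule: generate.induct)
  case one
  show ?case by (simp add: FG_one)
next
  case (incl h)
  then show ?case using run_word by auto
next
  case (inv h)
  then have "run {} h {}" "h \<in> carrier FG" using run_word of_word_in_FG by auto
  then show ?case using run_foldr_cons_red[of "{}" "rev (map inv_letter h)" "[]" "{}"] run_inverse[of "{}" h "{}"]
    by (simp add: FG_inv)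
next
  case (eng g h)
  then show ?case
    unfolding FG_mult by (intro run_foldr_cons_red) (auto simp: run_append)
qed

text \<open>The loop is an edge coming from some \<open>p @ a # z\<close> in \<open>X\<close>. Its
  source forces \<open>p\<close> to be empty, since a proper prefix is not in \<open>X\<close>; its
  target then puts \<open>[a]\<close> into \<open>X\<close>.\<close>

lemma letter_mem:
  assumes "gen a \<in> generate FG (of_word ` X)" shows "[a] \<in> X"
proof -
  have "edge {} a {}" using run_generate[OF assms] by (auto simp: of_word_def)
  then obtain p z where p: "p @ a # z \<in> X" "state p = {}" "state (p @ [a]) = {}"
    by (auto simp: edge_def)
  then have "p = []" using state_empty_iff proper_prefix_notin by blast
  then show ?thesis using p(3) state_empty_iff by auto
qed

lemma eq_letters:
  assumes "\<And>a. gen a \<in> generate FG (of_word ` X)" shows "X = range (\<lambda>a. [a])"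
proof -
  have "x \<in> range (\<lambda>a. [a])" if "x \<in> X" for x
  proof -
    have "x \<noteq> []" using that nonempty by metis
    then obtain a y where x: "x = a # y" by (cases x) auto
    then have "prefix [a] x" by simp
    then have "[a] = x" using that pre letter_mem[OF assms] unfolding prefix_code_def by blast
    then show ?thesis by blast
  qed
  moreover have "[a] \<in> X" for a using letter_mem[OF assms] .
  ultimately show ?thesis by blast
qed

end

section \<open>Automorphisms of the free group\<close>

lemma FG_Cons:
  assumes "l # w \<in> carrier FG" shows "l # w = [l] \<otimes>\<^bsub>FG\<^esub> w"
  using assms by (simp add: FG_mult FG_carrier cons_red_eq_Cons)

lemma inv_gen: "inv\<^bsub>FG\<^esub> (gen a) = [(a, False)]"
  by (subst FG_inv[OF of_word_in_FG]) (simp add: of_word_def inv_letter_def)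

lemma hom_FG_eqI:
  assumes G: "group G" and h: "h \<in> hom FG G" and k: "k \<in> hom FG G"
    and gens: "\<And>a. h (gen a) = k (gen a)" and w: "w \<in> carrier FG"
  shows "h w = k w"
proof -
  interpret h: group_hom FG G h using G h group_free_group
    by (auto simp: group_hom_def group_hom_axioms_def)
  interpret k: group_hom FG G k using G k group_free_group
    by (auto simp: group_hom_def group_hom_axioms_def)
  have letter: "h [l] = k [l]" for l
  proof (cases l)
    case (Pair a s)
    show ?thesis
    proof (cases s)
      case True
      then show ?thesis using gens[of a] Pair by (simp add: of_word_def)
    next
      case False
      then have "[l] = inv\<^bsub>FG\<^esub> (gen a)" by (simp add: inv_gen Pair)
      then show ?thesis using gens by (simp add: h.hom_inv k.hom_inv of_word_in_FG)
    qed
  qed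
  show ?thesis using w
  proof (induction w)
    case Nil
    then show ?case using h.hom_one k.hom_one by (simp add: FG_one)
  next
    case (Cons l w)
    then have w: "w \<in> carrier FG" "[l] \<in> carrier FG"
      by (auto simp: FG_carrier dest: reduced_ConsD)
    then show ?case
      using FG_Cons[OF Cons.prems] letter Cons.IH h.hom_mult k.hom_mult by metis
  qed
qed

text \<open>The extension of \<open>f\<close> given by the universal property, defined on unreduced
  words too so that values before and after a cancellation can be compared.\<close>

definition ext_hom :: "('a \<Rightarrow> ('a \<times> bool) list) \<Rightarrow> ('a \<times> bool) list \<Rightarrow> ('a \<times> bool) list" where
  "ext_hom f w = eval_word FG (map (\<lambda>(a, s). (f a, s)) w)"

lemma ext_hom_Nil: "ext_hom f [] = \<one>\<^bsub>FG\<^esub>"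
  by (simp add: ext_hom_def eval_word_def)

lemma ext_hom_Cons: "ext_hom f ((a, s) # w) = (if s then f a else inv\<^bsub>FG\<^esub> (f a)) \<otimes>\<^bsub>FG\<^esub> ext_hom f w"
  by (simp add: ext_hom_def eval_word_def)

context
  fixes f :: "'a \<Rightarrow> ('a \<times> bool) list"
  assumes f: "\<And>a. f a \<in> carrier FG"
begin

interpretation FG: group FG by (rule group_free_group)

lemma ext_hom_closed: "ext_hom f w \<in> carrier FG"
proof (induction w)
  case (Cons l w)
  then show ?case using f by (cases l) (auto simp: ext_hom_Cons)
qed (simp add: ext_hom_Nil)

lemma ext_hom_cons_red: "ext_hom f (cons_red l w) = ext_hom f (l # w)"
proof (cases "\<exists>w'. w = inv_letter l # w'")
  case True
  then obtain w' where w: "w = inv_letter l # w'" by blast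
  obtain a s where l: "l = (a, s)" by (cases l)
  show ?thesis
    using f ext_hom_closed
    by (simp add: w l inv_letter_def ext_hom_Cons FG.m_assoc[symmetric] FG.r_inv FG.l_inv)
next
  case False
  then have "cons_red l w = l # w" by (cases w) auto
  then show ?thesis by simp
qed

lemma ext_hom_foldr: "ext_hom f (foldr cons_red u v) = ext_hom f u \<otimes>\<^bsub>FG\<^esub> ext_hom f v"
proof (induction u)
  case (Cons l u)
  then show ?case using f ext_hom_closed
    by (cases l) (auto simp: ext_hom_cons_red ext_hom_Cons FG.m_assoc)
qed (simp add: ext_hom_Nil ext_hom_closed)

lemma ext_hom_hom: "ext_hom f \<in> hom FG FG"
  by (rule homI) (simp_all add: ext_hom_closed ext_hom_foldr FG_mult)

lemma ext_hom_gen: "ext_hom f (gen a) = f a"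
  using f by (simp add: of_word_def ext_hom_Cons ext_hom_Nil)

end

text \<open>Homomorphisms are determined by their values on letters, so both composites are the
  identity on the carrier once they fix the letters. The restriction provides the extensionality
  required by \<open>auto\<close>.\<close>

lemma ext_hom_auto:
  fixes f g :: "'a \<Rightarrow> ('a \<times> bool) list"
  assumes f: "\<And>a. f a \<in> carrier FG" and g: "\<And>a. g a \<in> carrier FG"
    and fg: "\<And>a. ext_hom f (g a) = gen a" and gf: "\<And>a. ext_hom g (f a) = gen a"
  shows "restrict (ext_hom f) (carrier FG) \<in> auto FG"
proof -
  have inverse: "ext_hom h (ext_hom k w) = w"
    if h: "\<And>a. h a \<in> carrier FG" and k: "\<And>a. k a \<in> carrier FG"
      and hk: "\<And>a. ext_hom h (k a) = gen a" and w: "w \<in> carrier FG"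
    for h k :: "'a \<Rightarrow> ('a \<times> bool) list" and w
  proof -
    have "(ext_hom h \<circ> ext_hom k) w = id w"
    proof (rule hom_FG_eqI[OF group_free_group _ _ _ w])
      show "ext_hom h \<circ> ext_hom k \<in> hom FG FG"
        using ext_hom_hom[of h, OF h] ext_hom_hom[of k, OF k] by (rule hom_compose[rotated])
      show "id \<in> hom FG FG" by (simp add: hom_def)
    qed (simp add: ext_hom_gen[of k, OF k] hk)
    then show ?thesis by simp
  qed
  have "bij_betw (ext_hom f) (carrier FG) (carrier FG)"
    by (rule bij_betw_byWitness[of _ "ext_hom g"])
      (use inverse[of f g, OF f g fg] inverse[of g f, OF g f gf] ext_hom_closed[of f, OF f] ext_hom_closed[of g, OF g] in auto)
  then have "bij_betw (restrict (ext_hom f) (carrier FG)) (carrier FG) (carrier FG)"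
    by (simp add: bij_betw_cong[of "carrier FG" "restrict (ext_hom f) (carrier FG)" "ext_hom f"])
  moreover have "restrict (ext_hom f) (carrier FG) \<in> hom FG FG"
  proof (rule homI)
    fix x y :: "('a \<times> bool) list" assume xy: "x \<in> carrier FG" "y \<in> carrier FG"
    show "restrict (ext_hom f) (carrier FG) x \<in> carrier FG" using xy ext_hom_closed[of f, OF f] by simp
    have "x \<otimes>\<^bsub>FG\<^esub> y \<in> carrier FG"
      by (rule monoid.m_closed[OF group.is_monoid[OF group_free_group] xy])
    then show "restrict (ext_hom f) (carrier FG) (x \<otimes>\<^bsub>FG\<^esub> y) =
        restrict (ext_hom f) (carrier FG) x \<otimes>\<^bsub>FG\<^esub> restrict (ext_hom f) (carrier FG) y"
      using xy hom_mult[OF ext_hom_hom[of f, OF f]] by simp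
  qed
  ultimately show ?thesis by (simp add: auto_def Bij_def)
qed

lemma of_word_pair: "of_word [a, b] = gen a \<otimes>\<^bsub>FG\<^esub> gen b"
  using of_word_append[of "[a]" "[b]"] by simp

lemma transvection_exists:
  assumes ab: "a \<noteq> (b :: 'a)" and u: "u = of_word [a, b] \<or> u = of_word [b, a]"
  shows "\<exists>\<beta>\<in>auto FG. \<beta> (gen b) = u \<and> (\<forall>c. c \<noteq> b \<longrightarrow> \<beta> (gen c) = gen c)"
proof -
  interpret FG: group "FG :: ('a \<times> bool) list monoid" by (rule group_free_group)
  note [simp] = of_word_in_FG
  \<comment> \<open>\<open>v\<close> is the image of \<open>b\<close> under the inverse: it undoes
    the multiplication by \<open>a\<close> on the side where it took place.\<close>
  define v where "v = (if u = of_word [a, b] then inv\<^bsub>FG\<^esub> (gen a) \<otimes>\<^bsub>FG\<^esub> gen b else gen b \<otimes>\<^bsub>FG\<^esub> inv\<^bsub>FG\<^esub> (gen a))"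
  define f where "f c = (if c = b then u else gen c)" for c
  define g where "g c = (if c = b then v else gen c)" for c
  have f: "f c \<in> carrier FG" and g: "g c \<in> carrier FG" for c
    using u by (auto simp: f_def g_def v_def)
  interpret F: group_hom FG FG "ext_hom f"
    using ext_hom_hom[of f, OF f] by (auto simp: group_hom_def group_hom_axioms_def group_free_group)
  interpret G: group_hom FG FG "ext_hom g"
    using ext_hom_hom[of g, OF g] by (auto simp: group_hom_def group_hom_axioms_def group_free_group)
  have fa: "ext_hom f (gen a) = gen a" "ext_hom f (gen b) = u"
    and ga: "ext_hom g (gen a) = gen a" "ext_hom g (gen b) = v"
    using ab by (simp_all add: ext_hom_gen[of f, OF f] ext_hom_gen[of g, OF g]) (simp_all add: f_def g_def)
  have "ext_hom f v = gen b \<and> ext_hom g u = gen b"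
  proof (cases "u = of_word [a, b]")
    case True
    then show ?thesis
      using fa ga by (simp add: v_def of_word_pair FG.m_assoc[symmetric])
  next
    case False
    with u have "u = of_word [b, a]" by blast
    then show ?thesis using fa ga False by (simp add: v_def of_word_pair FG.m_assoc)
  qed
  then have "ext_hom f (g c) = gen c" "ext_hom g (f c) = gen c" for c
    using ext_hom_gen[of f c, OF f] ext_hom_gen[of g c, OF g] by (auto simp: f_def g_def)
  then have "restrict (ext_hom f) (carrier FG) \<in> auto FG"
    using f g by (intro ext_hom_auto)
  then show ?thesis
    by (rule bexI[rotated]) (auto simp: ext_hom_gen[of f, OF f], auto simp: f_def)
qed

section \<open>Elementary steps on tame automorphisms\<close>

lemma tame_auto_id: "tame_auto (\<one>\<^bsub>AutoGroup FG\<^esub>)"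
proof -
  have "\<one>\<^bsub>AutoGroup FG\<^esub> \<in> auto FG"
    using group.subgroup_auto[OF group_free_group] by (auto simp: AutoGroup_def dest: subgroup.one_closed)
  moreover have "\<one>\<^bsub>AutoGroup FG\<^esub> (gen a) = gen a" for a :: 'a
    by (simp add: AutoGroup_def BijGroup_def of_word_in_FG)
  ultimately show ?thesis
    by (auto simp: tame_auto_def positive_auto_def positive_words_def intro: submonoid_generated.one)
qed

text \<open>An elementary automorphism is applied before \<open>\<alpha>\<close>: it sends
  \<open>b\<close> to a product of \<open>a\<close> and \<open>b\<close>, which
  \<open>\<alpha>\<close> turns into the product of \<open>x\<close> and \<open>y\<close> in the
  same order.\<close>

lemma tame_auto_transvect:
  assumes \<alpha>: "tame_auto \<alpha>" and ab: "a \<noteq> (b :: 'a)"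
    and ux: "\<alpha> (gen a) = of_word x" and vy: "\<alpha> (gen b) = of_word y"
    and w: "w = x @ y \<or> w = y @ x"
  shows "\<exists>\<gamma>. tame_auto \<gamma> \<and> \<gamma> (gen b) = of_word w \<and> (\<forall>c. c \<noteq> b \<longrightarrow> \<gamma> (gen c) = \<alpha> (gen c))"
proof -
  define u where "u = (if w = x @ y then of_word [a, b] else of_word [b, a])"
  then have "u = of_word [a, b] \<or> u = of_word [b, a]" by metis
  from transvection_exists[OF ab this] obtain \<beta> where
    \<beta>: "\<beta> \<in> auto FG" "\<beta> (gen b) = u" "\<forall>c. c \<noteq> b \<longrightarrow> \<beta> (gen c) = gen c" by blast
  have \<alpha>': "\<alpha> \<in> auto FG" using \<alpha> by (simp add: tame_auto_def positive_auto_def)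
  \<comment> \<open>\<open>\<beta>\<close> multiplies the letter \<open>b\<close> by
    \<open>a\<close>, so the two letters are exchanged compared with the definitions of the
    generators.\<close>
  have \<beta>_gen: "\<beta> \<in> left_mult_autos \<union> right_mult_autos"
  proof (cases "w = x @ y")
    case True
    then have "b \<noteq> a \<and> \<beta> (gen b) = of_word [a, b] \<and> (\<forall>c. c \<noteq> b \<longrightarrow> \<beta> (gen c) = gen c)"
      using \<beta> ab by (simp add: u_def)
    with \<beta>(1) have "\<beta> \<in> left_mult_autos"
      unfolding left_mult_autos_def mem_Collect_eq by (rule conjI[OF _ exI[of _ b, OF exI[of _ a]]])
    then show ?thesis by blast
  next
    case False
    then have "b \<noteq> a \<and> \<beta> (gen b) = of_word [b, a] \<and> (\<forall>c. c \<noteq> b \<longrightarrow> \<beta> (gen c) = gen c)"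
      using \<beta> ab by (simp add: u_def)
    with \<beta>(1) have "\<beta> \<in> right_mult_autos"
      unfolding right_mult_autos_def mem_Collect_eq by (rule conjI[OF _ exI[of _ b, OF exI[of _ a]]])
    then show ?thesis by blast
  qed
  define \<gamma> where "\<gamma> = \<alpha> \<otimes>\<^bsub>AutoGroup FG\<^esub> \<beta>"
  have \<gamma>: "\<gamma> = compose (carrier FG) \<alpha> \<beta>"
    using \<alpha>' \<beta>(1) by (simp add: \<gamma>_def AutoGroup_def BijGroup_def auto_def)
  have hom: "\<alpha> \<in> hom FG FG" using \<alpha>' by (simp add: auto_def)
  have "\<alpha> u = of_word w"
    using w ux vy hom_mult[OF hom of_word_in_FG of_word_in_FG]
    by (auto simp: u_def of_word_pair of_word_append)
  then have \<gamma>b: "\<gamma> (gen b) = of_word w" by (simp add: \<gamma> compose_def of_word_in_FG \<beta>(2))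
  have \<gamma>c: "\<gamma> (gen c) = \<alpha> (gen c)" if "c \<noteq> b" for c
    using that \<beta>(3) by (simp add: \<gamma> compose_def of_word_in_FG)
  have "\<gamma> \<in> auto FG"
    using \<alpha>' \<beta>(1) group.AutoGroup[OF group_free_group] group.is_monoid monoid.m_closed
    unfolding \<gamma>_def by (fastforce simp: AutoGroup_def)
  moreover have "\<alpha> (gen c) \<in> positive_words" for c
    using \<alpha> by (simp add: tame_auto_def positive_auto_def)
  moreover have "of_word w \<in> positive_words"
  proof -
    have "x \<noteq> []" using \<open>\<alpha> (gen a) \<in> positive_words\<close> ux by (auto simp: positive_words_def of_word_def)
    then show ?thesis using w by (auto simp: positive_words_def)
  qed
  ultimately have "positive_auto \<gamma>"
    unfolding positive_auto_def using \<gamma>b \<gamma>c by metis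
  moreover have "\<gamma> \<in> submonoid_generated (AutoGroup FG) (perm_autos \<union> right_mult_autos \<union> left_mult_autos)"
    unfolding \<gamma>_def
  proof (rule submonoid_generated.mult)
    show "\<beta> \<in> submonoid_generated (AutoGroup FG) (perm_autos \<union> right_mult_autos \<union> left_mult_autos)"
      using \<beta>_gen by (intro submonoid_generated.incl) blast
  qed (use \<alpha> in \<open>simp add: tame_auto_def\<close>)
  ultimately show ?thesis using \<gamma>b \<gamma>c by (auto simp: tame_auto_def)
qed

section \<open>Bases of the free group\<close>

lemma generate_basis:
  fixes X :: "('a \<times> bool) list set"
  assumes "free_basis FG X" shows "generate FG X = carrier FG"
proof -
  interpret FG: group "FG :: ('a \<times> bool) list monoid" by (rule group_free_group)
  have X: "X \<subseteq> carrier FG" and iso: "eval_word FG \<in> iso (free_group X) FG"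
    using assms by (auto simp: free_basis_def)
  have eval: "eval_word FG w \<in> generate FG X" if "fst ` set w \<subseteq> X" for w
    using that
  proof (induction w)
    case Nil
    then show ?case by (simp add: eval_word_def generate.one)
  next
    case (Cons l w)
    obtain x s where l: "l = (x, s)" by (cases l)
    have "eval_word FG (l # w) = (if s then x else inv\<^bsub>FG\<^esub> x) \<otimes>\<^bsub>FG\<^esub> eval_word FG w"
      by (simp add: eval_word_def l)
    moreover have "x \<in> X" "eval_word FG w \<in> generate FG X" using Cons l by simp_all
    moreover from this(1) have "(if s then x else inv\<^bsub>FG\<^esub> x) \<in> generate FG X"
      by (simp add: generate.incl generate.inv)
    ultimately show ?case by (simp only: generate.eng)
  qed
  have "carrier FG \<subseteq> generate FG X"
  proof
    fix g :: "('a \<times> bool) list" assume "g \<in> carrier FG"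
    then have "g \<in> eval_word FG ` carrier (free_group X)"
      using iso by (simp add: iso_def bij_betw_def)
    then obtain w where "w \<in> carrier (free_group X)" "g = eval_word FG w" by blast
    then show "g \<in> generate FG X" using eval[of w] by (simp add: free_group_def)
  qed
  then show ?thesis using FG.generate_incl[OF X] by blast
qed

section \<open>Rank bound through the group of order two\<close>

definition parity :: "'x set \<Rightarrow> ('x \<times> bool) list \<Rightarrow> bool" where
  "parity T w = even (length (filter (\<lambda>l. fst l \<in> T) w))"

text \<open>A cancellation removes two letters over the same generator and so keeps the
  parity.\<close>

lemma parity_cons_red: "parity T (cons_red l w) = parity T (l # w)"
  by (cases w) (auto simp: parity_def)

lemma parity_foldr: "parity T (foldr cons_red u v) \<longleftrightarrow> (parity T u \<longleftrightarrow> parity T v)"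
proof (induction u)
  case (Cons l u)
  have Cons_iff: "parity T (l # w) \<longleftrightarrow> (parity T [l] \<longleftrightarrow> parity T w)" for w by (auto simp: parity_def)
  have "parity T (foldr cons_red (l # u) v) \<longleftrightarrow> (parity T [l] \<longleftrightarrow> parity T (foldr cons_red u v))"
    using Cons_iff[of "foldr cons_red u v"] by (simp only: foldr_Cons comp_apply parity_cons_red)
  then show ?case using Cons.IH Cons_iff[of u] by blast
qed (simp add: parity_def)

text \<open>Equivalence is the product and \<open>True\<close> the neutral element because
  \<open>parity\<close> holds for even counts.\<close>

definition Z2 :: "bool monoid" where
  "Z2 = \<lparr>carrier = UNIV, mult = (\<longleftrightarrow>), one = True\<rparr>"

lemma group_Z2: "group Z2"
  by (rule groupI) (auto simp: Z2_def)

text \<open>Distinct subsets of a basis give distinct homomorphisms to the group of order two, and a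
  homomorphism is determined by its values on the letters.\<close>

lemma card_basis:
  fixes X :: "('a::finite \<times> bool) list set"
  assumes "free_basis FG X"
  shows "finite X" "card X \<le> card (UNIV :: 'a set)"
proof -
  have X: "X \<subseteq> carrier FG" and iso: "eval_word FG \<in> iso (free_group X) FG"
    using assms by (auto simp: free_basis_def)
  \<comment> \<open>\<open>e\<close> rewrites an element in terms of the basis \<open>X\<close>;
    counting letters from \<open>T\<close> modulo two in the result gives the character
    \<open>\<chi> T\<close>.\<close>
  define e where "e = inv_into (carrier (free_group X)) (eval_word FG)"
  have "e \<in> iso FG (free_group X)"
    unfolding e_def by (rule group.iso_set_sym[OF group_free_group iso])
  then have e: "e \<in> hom FG (free_group X)" by (simp add: iso_def)
  define \<chi> where "\<chi> T = parity T \<circ> e" for T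
  have hom: "\<chi> T \<in> hom FG Z2" for T
    using e by (auto simp: hom_def \<chi>_def Z2_def free_group_def parity_foldr)
  have basis: "\<chi> T x \<longleftrightarrow> x \<notin> T" if "x \<in> X" for x T
  proof -
    have "[(x, True)] \<in> carrier (free_group X)" using that by (simp add: free_group_def)
    moreover have "eval_word FG [(x, True)] = x"
      using that X by (auto simp: eval_word_def group.is_monoid[OF group_free_group] monoid.r_one)
    moreover have "inj_on (eval_word FG) (carrier (free_group X))"
      using iso by (simp add: iso_def bij_betw_def)
    ultimately have "e x = [(x, True)]" unfolding e_def by (metis inv_into_f_f)
    then show ?thesis by (simp add: \<chi>_def parity_def)
  qed
  \<comment> \<open>\<open>\<Phi>\<close> records a character by the letters in its kernel. Its
    injectivity on subsets of \<open>X\<close> gives finiteness first and then a comparison of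
    powers of two.\<close>
  define \<Phi> where "\<Phi> T = {a. \<chi> T (gen a)}" for T
  have inj: "inj_on \<Phi> (Pow X)"
  proof (rule inj_onI)
    fix T U assume TU: "T \<in> Pow X" "U \<in> Pow X" and "\<Phi> T = \<Phi> U"
    then have "\<chi> T (gen a) = \<chi> U (gen a)" for a by (auto simp: \<Phi>_def)
    then have "\<chi> T x = \<chi> U x" if "x \<in> X" for x
      using hom_FG_eqI[OF group_Z2 hom hom] that X by blast
    then show "T = U" using basis TU by blast
  qed
  then have "finite (Pow X)" by (rule inj_on_finite[of _ _ UNIV]) auto
  then show fin: "finite X" by simp
  have "card (Pow X) \<le> card (Pow (UNIV :: 'a set))" using inj by (rule card_inj_on_le) auto
  then have "(2::nat) ^ card X \<le> 2 ^ card (UNIV :: 'a set)"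
    using fin by (simp only: card_Pow finite)
  then show "card X \<le> card (UNIV :: 'a set)" by simp
qed

text \<open>This undoes one shortening step: the letter sent to \<open>v\<close> is redirected to
  \<open>y\<close>, the product of \<open>u\<close> and \<open>v\<close>, and all other letters keep
  their images.\<close>

lemma tame_auto_replace:
  fixes Y :: "'a::finite list set"
  assumes \<alpha>: "tame_auto \<alpha>" "of_word ` insert v (Y - {y}) = \<alpha> ` range gen"
    and Y: "finite Y" "card Y \<le> card (UNIV :: 'a set)" and uy: "u \<in> Y" "y \<in> Y" "u \<noteq> y"
    and y: "y = u @ v \<or> y = v @ u"
  shows "\<exists>\<gamma>. tame_auto \<gamma> \<and> of_word ` Y = \<gamma> ` range gen"
proof -
  have "bij_betw \<alpha> (carrier FG) (carrier FG)"
    using \<alpha>(1) by (simp add: tame_auto_def positive_auto_def auto_def Bij_def)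
  then have "inj_on \<alpha> (range gen)"
    by (rule inj_on_subset[OF bij_betw_imp_inj_on]) (auto simp: of_word_in_FG)
  moreover have "inj (gen :: 'a \<Rightarrow> _)" by (auto simp: inj_def of_word_def)
  ultimately have inj: "inj (\<lambda>a. \<alpha> (gen a))" by (auto simp: inj_def inj_on_def)
  have "card (insert v (Y - {y})) = card (of_word ` insert v (Y - {y}))"
    by (rule card_image[symmetric]) (rule inj_on_subset[OF inj_of_word], simp)
  also have "\<dots> = card (UNIV :: 'a set)"
    unfolding \<alpha>(2) image_image by (rule card_image[OF inj])
  finally have card: "card (insert v (Y - {y})) = card (UNIV :: 'a set)" .
  \<comment> \<open>Otherwise the new set would have fewer words than \<open>Y\<close> and hence
    fewer than there are letters, although \<open>\<alpha>\<close> maps the letters bijectively onto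
    its image in the free group.\<close>
  have v: "v \<notin> Y - {y}"
  proof
    assume "v \<in> Y - {y}"
    then have "card (Y - {y}) = card (UNIV :: 'a set)" using card by (simp add: insert_absorb)
    moreover have "card (Y - {y}) < card Y" using Y(1) uy(2) by (rule card_Diff1_less)
    ultimately show False using Y(2) by linarith
  qed
  have "of_word u \<in> \<alpha> ` range gen" "of_word v \<in> \<alpha> ` range gen"
    unfolding \<alpha>(2)[symmetric] using uy by auto
  then obtain a b where ab: "\<alpha> (gen a) = of_word u" "\<alpha> (gen b) = of_word v" by force
  have "a \<noteq> b"
  proof
    assume "a = b"
    then have "u = v" using ab inj_of_word by (metis injD)
    with v uy show False by blast
  qed
  from tame_auto_transvect[OF \<alpha>(1) this ab y] obtain \<gamma> where
    \<gamma>: "tame_auto \<gamma>" "\<gamma> (gen b) = of_word y" "\<And>c. c \<noteq> b \<Longrightarrow> \<gamma> (gen c) = \<alpha> (gen c)" by blast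
  have "range h = insert (h b) (h ` (- {b}))" for h :: "'a \<Rightarrow> ('a \<times> bool) list"
    by blast
  from this[of "\<lambda>c. \<gamma> (gen c)"] have "\<gamma> ` range gen = insert (of_word y) ((\<lambda>c. \<gamma> (gen c)) ` (- {b}))"
    using \<gamma>(2) by (simp add: image_image)
  also have "(\<lambda>c. \<gamma> (gen c)) ` (- {b}) = (\<lambda>c. \<alpha> (gen c)) ` (- {b})"
    using \<gamma>(3) by (intro image_cong) auto
  also have "\<dots> = range (\<lambda>c. \<alpha> (gen c)) - {\<alpha> (gen b)}"
    using inj by (auto simp: inj_def)
  also have "\<dots> = of_word ` insert v (Y - {y}) - {of_word v}"
    using \<alpha>(2) ab(2) by (simp add: image_image)
  also have "\<dots> = of_word ` (Y - {y})"
    using v inj_of_word by (auto simp: inj_def)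
  also have "insert (of_word y) \<dots> = of_word ` Y" using uy(2) by auto
  finally show ?thesis using \<gamma>(1) by metis
qed

text \<open>Generation together with a bound on the number of words stands in for freeness, because
  both survive the replacement of \<open>y\<close> by \<open>v\<close>. The total length decreases
  until a bifix code is left.\<close>

lemma tame_if_generating:
  fixes S Y :: "'a::finite list set"
  assumes "acyclic_set S" "Y \<subseteq> S" "finite Y" "[] \<notin> Y" "card Y \<le> card (UNIV :: 'a set)"
    and "carrier FG \<subseteq> generate FG (of_word ` Y)"
  shows "\<exists>\<alpha>. tame_auto \<alpha> \<and> of_word ` Y = \<alpha> ` range gen"
  using assms(2-)
proof (induction "\<Sum>y\<in>Y. length y" arbitrary: Y rule: less_induct)
  case less
  interpret FG: group "FG :: ('a \<times> bool) list monoid" by (rule group_free_group)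
  show ?case
  proof (cases "prefix_code Y \<and> suffix_code Y")
    case True
    then interpret bifix_acyclic S Y
      using assms(1) less.prems by unfold_locales auto
    have "Y = range (\<lambda>a. [a])"
      using less.prems(5) of_word_in_FG by (intro eq_letters) blast
    moreover have "\<one>\<^bsub>AutoGroup FG\<^esub> (gen a) = gen a" for a :: 'a
      by (simp add: AutoGroup_def BijGroup_def of_word_in_FG)
    ultimately have "of_word ` Y = \<one>\<^bsub>AutoGroup FG\<^esub> ` range gen" by (simp add: image_image)
    then show ?thesis using tame_auto_id by blast
  next
    case False
    then obtain u v y where uy: "u \<in> Y" "y \<in> Y" "u \<noteq> y" and y: "y = u @ v \<or> y = v @ u"
      unfolding prefix_code_def suffix_code_def prefix_def suffix_def by blast
    define Y' where "Y' = insert v (Y - {y})"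
    have "v \<noteq> []" "u \<noteq> []" using uy y less.prems(3) by auto
    have "sublist v y" using y by (auto simp: sublist_append_leftI sublist_append_rightI)
    then have "v \<in> S" using acyclic_setD[OF assms(1)] less.prems(1) uy by blast
    have gy: "of_word y \<in> generate FG (of_word ` Y')"
    proof -
      have "of_word u \<in> generate FG (of_word ` Y')" "of_word v \<in> generate FG (of_word ` Y')"
        using uy by (auto simp: Y'_def intro: generate.incl)
      then show ?thesis using y by (auto simp: of_word_append intro: generate.eng)
    qed
    have "\<exists>\<alpha>. tame_auto \<alpha> \<and> of_word ` Y' = \<alpha> ` range gen"
    proof (rule less.hyps)
      \<comment> \<open>Only an inequality is available here, since \<open>v\<close> could already
        belong to \<open>Y - {y}\<close>.\<close>
      have "(\<Sum>y\<in>Y'. length y) \<le> length v + (\<Sum>y\<in>Y - {y}. length y)"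
        unfolding Y'_def using less.prems(2) by (simp add: sum.insert_if)
      also have "\<dots> < length y + (\<Sum>y\<in>Y - {y}. length y)" using y \<open>u \<noteq> []\<close> by auto
      also have "\<dots> = (\<Sum>y\<in>Y. length y)" using less.prems(2) uy(2) by (simp add: sum.remove)
      finally show "(\<Sum>y\<in>Y'. length y) < (\<Sum>y\<in>Y. length y)" .
      show "Y' \<subseteq> S" "finite Y'" "[] \<notin> Y'"
        using less.prems \<open>v \<in> S\<close> \<open>v \<noteq> []\<close> by (auto simp: Y'_def)
      have "card Y' \<le> Suc (card (Y - {y}))" unfolding Y'_def by (rule card_insert_le_m1) auto
      also have "\<dots> = card Y" using less.prems(2) uy(2) by (rule card_Suc_Diff1)
      finally show "card Y' \<le> card (UNIV :: 'a set)" using less.prems(4) by simp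
      have Y'FG: "of_word ` Y' \<subseteq> carrier FG" using of_word_in_FG by auto
      have "of_word ` Y \<subseteq> generate FG (of_word ` Y')"
      proof (clarify)
        fix x assume "x \<in> Y"
        then show "of_word x \<in> generate FG (of_word ` Y')"
          using gy by (cases "x = y") (auto simp: Y'_def intro: generate.incl)
      qed
      then have "generate FG (of_word ` Y) \<subseteq> generate FG (of_word ` Y')"
        by (rule FG.generate_subgroup_incl[OF _ FG.generate_is_subgroup[OF Y'FG]])
      then show "carrier FG \<subseteq> generate FG (of_word ` Y')" using less.prems(5) by blast
    qed
    then obtain \<alpha> where "tame_auto \<alpha>" "of_word ` insert v (Y - {y}) = \<alpha> ` range gen"
      unfolding Y'_def by blast
    then show ?thesis using less.prems(2,4) uy y by (rule tame_auto_replace)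
  qed
qed

theorem theorem5p19:
  fixes S :: "'a::finite list set" and X :: "('a \<times> bool) list set"
  assumes "uniformly_recurrent S"
    and "tree_set S"
    and "free_basis FG X"
    and "X \<subseteq> of_word ` S"
  shows "tame_basis X"
proof -
  define Y where "Y = {w \<in> S. of_word w \<in> X}"
  have XY: "X = of_word ` Y" using assms(4) by (auto simp: Y_def)
  have inj: "inj_on of_word Y" by (rule inj_on_subset[OF inj_of_word]) simp
  \<comment> \<open>The empty word is the neutral element; as a basis element it would have the same
    value as the empty product, against injectivity of evaluation.\<close>
  have "[] \<notin> X"
  proof
    assume "[] \<in> X"
    then have "[([], True)] \<in> carrier (free_group X)" by (simp add: free_group_def)
    moreover have "[] \<in> carrier (free_group X)" by (simp add: free_group_def)
    moreover have "eval_word FG [([], True)] = eval_word FG []"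
      by (simp add: eval_word_def FG_mult FG_one)
    moreover have "inj_on (eval_word FG) (carrier (free_group X))"
      using assms(3) by (simp add: free_basis_def iso_def bij_betw_def)
    ultimately show False by (metis inj_onD list.distinct(1))
  qed
  then have nil: "[] \<notin> Y" by (auto simp: Y_def of_word_def)
  have "finite Y" "card Y \<le> card (UNIV :: 'a set)"
    using card_basis[OF assms(3)] inj by (simp_all add: XY finite_image_iff card_image)
  moreover have "carrier FG \<subseteq> generate FG (of_word ` Y)"
    using generate_basis[OF assms(3)] by (simp add: XY)
  moreover have "Y \<subseteq> S" by (auto simp: Y_def)
  ultimately have "\<exists>\<alpha>. tame_auto \<alpha> \<and> X = \<alpha> ` range gen"
    unfolding XY using acyclic_set_if_tree_set[OF assms(2)] nil by (intro tame_if_generating)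
  moreover have "X \<subseteq> positive_words" using nil by (auto simp: XY positive_words_def)
  ultimately show ?thesis using assms(3) by (simp add: tame_basis_def)
qed

end
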